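(* Let $\Omega=\Gamma\cup\Gamma^{-1}\cup\Xi\cup\Xi^{-1}$ and $\Omega_{\mathrm{inv}}=\{\mathbf X_{13},\mathbf X_{14},\mathbf X_{15},\mathbf X_{16}\}$ be as defined in the context, and let $\Omega_\sigma$ and $\Omega_{\mathrm{inv},\sigma}$ be their scaled families. Then every triangle center in $\Omega_\sigma$ is a semi-invariant curve-generating center with respect to every decomposable triangle family, and every triangle center in $\Omega_{\mathrm{inv},\sigma}$ is an invariant curve-generating center with respect to every decomposable triangle family.
   Context: **Triangles and centers.** $\triangle$ is the set of non-degenerate triangles $\Delta=(\mathbf A,\mathbf B,\mathbf C)$ in $\mathbb R^2$, with side lengths $a=|\mathbf B\mathbf C|$, $b=|\mathbf C\mathbf A|$, $c=|\mathbf A\mathbf B|$ and area $\mathrm{area}(\Delta)$ (a function of $a,b,c$). A triangle center function is a function $\psi\not\equiv 0$ of $(a,b,c)$ that is homogeneous of some real degree and satisfies $\psi(a,b,c)=\psi(a,c,b)$. Its trace is $\Sigma_\psi=a\psi(a,b,c)+b\psi(b,c,a)+c\psi(c,a,b)$, and it defines the triangle center $\mathbf X_\psi=\frac{1}{\Sigma_\psi}\left(a\psi(a,b,c)\mathbf A+b\psi(b,c,a)\mathbf B+c\psi(c,a,b)\mathbf C\right)$ whenever $\Sigma_\psi\ne0$. For $\psi^{-1}=1/\psi$ the trilinear coordinates $[1/\psi(a,b,c):1/\psi(b,c,a):1/\psi(c,a,b)]$ are read, if necessary after clearing denominators, as $[\psi(b,c,a)\psi(c,a,b):\psi(c,a,b)\psi(a,b,c):\psi(a,b,c)\psi(b,c,a)]$.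 $\mathbf X_2=\frac13(\mathbf A+\mathbf B+\mathbf C)$ is the centroid, with center function $\phi_2(a,b,c)=a^{-1}$, $\Sigma_{\phi_2}=3$. **The sets.** For real $(\lambda_0,\lambda_1)\neq(0,0)$ put $$\psi_{\Gamma;\lambda_0:\lambda_1}=\sqrt3\,a(-a^2+b^2+c^2)\lambda_0+4a\,\mathrm{area}(\Delta)\lambda_1,\qquad \psi_{\Xi;\lambda_0:\lambda_1}=-a(-a^2+b^2+c^2)\lambda_0+a(a^2+b^2+c^2)\lambda_1 .$$ $\Gamma$, $\Xi$ are the sets of all these functions and $\Gamma^{-1}$, $\Xi^{-1}$ the sets of their reciprocals. $\mathbf X_{15},\mathbf X_{16}$ correspond to $\psi_{\Gamma;1:1},\psi_{\Gamma;-1:1}$ and $\mathbf X_{13},\mathbf X_{14}$ to $\psi_{\Gamma;1:1}^{-1},\psi_{\Gamma;-1:1}^{-1}$. **Scaled families.** For a set $\Omega$ of triangle center functions, $\Omega_\sigma=\{\psi_\sigma\mid\psi\in\Omega,\ \sigma\in\mathbb R\}$, where $\psi_\sigma=(1-\sigma)\frac{\psi}{\Sigma_\psi}+\sigma\frac{\phi_2}{\Sigma_{\phi_2}}$; thus $\mathbf X_{\psi_\sigma}=(1-\sigma)\mathbf X_\psi+\sigma\mathbf X_2$. **Triangle families.** A triangle family $\mathbf\Psi=(\Psi_1,\Psi_2,\Psi_3):\mathbb R\to\mathbb R^3$ satisfies $\Psi_1(t)+\Psi_2(t)+\Psi_3(t)\ne0$ for all $t$ and not $\Psi_1\equiv\Psi_2\equiv\Psi_3$.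 Applied to $\Delta$, it yields triangles $\Delta_t^{\mathbf\Psi}$ with vertices of barycentric coordinates $\mathbf A_t=[\Psi_1:\Psi_2:\Psi_3]$, $\mathbf B_t=[\Psi_3:\Psi_1:\Psi_2]$, $\mathbf C_t=[\Psi_2:\Psi_3:\Psi_1]$ with respect to $\mathbf A,\mathbf B,\mathbf C$. It is decomposable if for all $t$, $2\Psi_1(t)-\Psi_2(t)-\Psi_3(t)=0$ implies $\Psi_1(t)=\Psi_2(t)=\Psi_3(t)$. **Triangle curves.** $\mathbf X_\psi^{\mathbf\Psi}(t)$ is the center of $\Delta_t^{\mathbf\Psi}$ determined by $\psi$ (using the side lengths of $\Delta_t^{\mathbf\Psi}$); if $\Psi_1(t)=\Psi_2(t)=\Psi_3(t)$, it is $\mathbf X_2$. Equilateral $\Delta$ are excluded throughout, and curves are considered where the center is defined. All $\Delta_t^{\mathbf\Psi}$ have centroid $\mathbf X_2$, and curves are compared relative to $\mathbf X_2$. **Semi-invariance.** $\mathbf X_\psi$ is a semi-invariant curve-generating center with respect to $\mathbf\Psi$ if the curves $t\mapsto\mathbf X_\psi^{\mathbf\Psi}(t)$ for different $\Delta$ differ only by an affine transformation: there are functions $l_x(t),l_y(t)$ independent of $\Delta$ and, for each $\Delta$, vectors $\mathbf V_x,\mathbf V_y\in\mathbb R^2$ with $\mathbf X_\psi^{\mathbf\Psi}(t)=\mathbf X_2+l_x(t)\mathbf V_x+l_y(t)\mathbf V_y$ for all $t$. **Invariance.** It is an invariant curve-generating center if the curves differ only by translation, rotation, scaling or reflection, i.e.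 in addition the linear maps $(x,y)\mapsto x\mathbf V_x+y\mathbf V_y$ can be chosen to be compositions of rotations, reflections and nonzero uniform scalings. *)

theory Defs
  imports "HOL-Analysis.Analysis"
begin

section \<open>Triangle center functions\<close>

type_synonym center_fun = "real \<Rightarrow> real \<Rightarrow> real \<Rightarrow> real"

definition triangle_sides :: "real \<Rightarrow> real \<Rightarrow> real \<Rightarrow> bool" where
  "triangle_sides a b c \<longleftrightarrow>
     0 < a \<and> 0 < b \<and> 0 < c \<and> a < b + c \<and> b < c + a \<and> c < a + b"

definition triangle_center_function :: "center_fun \<Rightarrow> bool" where
  "triangle_center_function \<psi> \<longleftrightarrow>
     (\<exists>a b c. triangle_sides a b c \<and> \<psi> a b c \<noteq> 0) \<and>
     (\<exists>d::real. \<forall>a b c k. triangle_sides a b c \<and> k > 0 \<longrightarrow>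
        \<psi> (k * a) (k * b) (k * c) = k powr d * \<psi> a b c) \<and>
     (\<forall>a b c. triangle_sides a b c \<longrightarrow> \<psi> a b c = \<psi> a c b)"

definition center_trace :: "center_fun \<Rightarrow> real \<Rightarrow> real \<Rightarrow> real \<Rightarrow> real" where
  "center_trace \<psi> a b c = a * \<psi> a b c + b * \<psi> b c a + c * \<psi> c a b"

definition center_defined :: "center_fun \<Rightarrow> real^2 \<Rightarrow> real^2 \<Rightarrow> real^2 \<Rightarrow> bool" where
  "center_defined \<psi> A B C \<longleftrightarrow> center_trace \<psi> (dist B C) (dist C A) (dist A B) \<noteq> 0"

definition center_of :: "center_fun \<Rightarrow> real^2 \<Rightarrow> real^2 \<Rightarrow> real^2 \<Rightarrow> real^2" where
  "center_of \<psi> A B C =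
     (let a = dist B C; b = dist C A; c = dist A B in
      (1 / center_trace \<psi> a b c) *\<^sub>R
        ((a * \<psi> a b c) *\<^sub>R A + (b * \<psi> b c a) *\<^sub>R B + (c * \<psi> c a b) *\<^sub>R C))"

definition centroid :: "real^2 \<Rightarrow> real^2 \<Rightarrow> real^2 \<Rightarrow> real^2" where
  "centroid A B C = (1/3) *\<^sub>R (A + B + C)"

definition area_of_sides :: center_fun where
  "area_of_sides a b c =
     (let s = (a + b + c) / 2 in sqrt (s * (s - a) * (s - b) * (s - c)))"

lemma area_of_sides_eq_measure:
  fixes A B C :: "real^2"
  shows "area_of_sides (dist B C) (dist C A) (dist A B) = measure lborel (convex hull {A, B, C})"
  by (simp add: area_of_sides_def heron dist_commute Let_def)

text \<open>
  The reciprocal of a center function with denominators cleared: the trilinear coordinates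
  \<open>[1/\<psi>(a,b,c) : 1/\<psi>(b,c,a) : 1/\<psi>(c,a,b)]\<close> multiplied by the common factor
  \<open>\<psi>(a,b,c) \<psi>(b,c,a) \<psi>(c,a,b)\<close>.  In this form it also makes sense where one of the three
  values vanishes; where none does, it agrees with \<open>1/\<psi>\<close> both in the center it defines and in
  all scaled versions (see the lemmas on \<open>recip_center\<close> below).
\<close>

definition recip_center :: "center_fun \<Rightarrow> center_fun" where
  "recip_center \<psi> a b c = \<psi> b c a * \<psi> c a b"


section \<open>The families of center functions\<close>

definition psi_Gamma :: "real \<Rightarrow> real \<Rightarrow> center_fun" where
  "psi_Gamma l0 l1 a b c =
     sqrt 3 * a * (- a\<^sup>2 + b\<^sup>2 + c\<^sup>2) * l0 + 4 * a * area_of_sides a b c * l1"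

definition psi_Xi :: "real \<Rightarrow> real \<Rightarrow> center_fun" where
  "psi_Xi l0 l1 a b c =
     - a * (- a\<^sup>2 + b\<^sup>2 + c\<^sup>2) * l0 + a * (a\<^sup>2 + b\<^sup>2 + c\<^sup>2) * l1"

definition Gamma_set :: "center_fun set" where
  "Gamma_set = {psi_Gamma l0 l1 | l0 l1. (l0, l1) \<noteq> (0, 0)}"

definition Xi_set :: "center_fun set" where
  "Xi_set = {psi_Xi l0 l1 | l0 l1. (l0, l1) \<noteq> (0, 0)}"

definition Omega :: "center_fun set" where
  "Omega = Gamma_set \<union> recip_center ` Gamma_set \<union> Xi_set \<union> recip_center ` Xi_set"

text \<open>The center functions of \<open>X\<^sub>1\<^sub>3, X\<^sub>1\<^sub>4, X\<^sub>1\<^sub>5, X\<^sub>1\<^sub>6\<close>, in this order.\<close>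

definition Omega_inv :: "center_fun set" where
  "Omega_inv = {recip_center (psi_Gamma 1 1), recip_center (psi_Gamma (-1) 1),
                psi_Gamma 1 1, psi_Gamma (-1) 1}"

definition phi2 :: center_fun where
  "phi2 a b c = 1 / a"

text \<open>
  Where the trace of \<open>\<psi>\<close> vanishes, the scaled function is undefined.  It is set to \<open>0\<close> there, so
  that its own trace is \<open>0\<close> as well and \<^const>\<open>center_defined\<close> is false.
\<close>

definition scaled_center :: "center_fun \<Rightarrow> real \<Rightarrow> center_fun" where
  "scaled_center \<psi> \<sigma> a b c =
     (if center_trace \<psi> a b c = 0 then 0
      else (1 - \<sigma>) * (\<psi> a b c / center_trace \<psi> a b c)
           + \<sigma> * (phi2 a b c / center_trace phi2 a b c))"

definition scaled_family :: "center_fun set \<Rightarrow> center_fun set" where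
  "scaled_family \<Omega> = {scaled_center \<psi> \<sigma> | \<psi> \<sigma>. \<psi> \<in> \<Omega>}"


section \<open>Triangle families and triangle curves\<close>

definition triangle_family :: "(real \<Rightarrow> real^3) \<Rightarrow> bool" where
  "triangle_family \<Psi> \<longleftrightarrow>
     (\<forall>t. \<Psi> t $ 1 + \<Psi> t $ 2 + \<Psi> t $ 3 \<noteq> 0) \<and>
     \<not> (\<forall>t. \<Psi> t $ 1 = \<Psi> t $ 2 \<and> \<Psi> t $ 2 = \<Psi> t $ 3)"

definition decomposable :: "(real \<Rightarrow> real^3) \<Rightarrow> bool" where
  "decomposable \<Psi> \<longleftrightarrow>
     (\<forall>t. 2 * \<Psi> t $ 1 - \<Psi> t $ 2 - \<Psi> t $ 3 = 0 \<longrightarrow>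
          \<Psi> t $ 1 = \<Psi> t $ 2 \<and> \<Psi> t $ 2 = \<Psi> t $ 3)"

definition barycentric :: "real^2 \<Rightarrow> real^2 \<Rightarrow> real^2 \<Rightarrow> real \<Rightarrow> real \<Rightarrow> real \<Rightarrow> real^2" where
  "barycentric A B C x y z = (1 / (x + y + z)) *\<^sub>R (x *\<^sub>R A + y *\<^sub>R B + z *\<^sub>R C)"

definition vertex_A :: "(real \<Rightarrow> real^3) \<Rightarrow> real^2 \<Rightarrow> real^2 \<Rightarrow> real^2 \<Rightarrow> real \<Rightarrow> real^2" where
  "vertex_A \<Psi> A B C t = barycentric A B C (\<Psi> t $ 1) (\<Psi> t $ 2) (\<Psi> t $ 3)"

definition vertex_B :: "(real \<Rightarrow> real^3) \<Rightarrow> real^2 \<Rightarrow> real^2 \<Rightarrow> real^2 \<Rightarrow> real \<Rightarrow> real^2" where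
  "vertex_B \<Psi> A B C t = barycentric A B C (\<Psi> t $ 3) (\<Psi> t $ 1) (\<Psi> t $ 2)"

definition vertex_C :: "(real \<Rightarrow> real^3) \<Rightarrow> real^2 \<Rightarrow> real^2 \<Rightarrow> real^2 \<Rightarrow> real \<Rightarrow> real^2" where
  "vertex_C \<Psi> A B C t = barycentric A B C (\<Psi> t $ 2) (\<Psi> t $ 3) (\<Psi> t $ 1)"

definition triangle_curve ::
  "center_fun \<Rightarrow> (real \<Rightarrow> real^3) \<Rightarrow> real^2 \<Rightarrow> real^2 \<Rightarrow> real^2 \<Rightarrow> real \<Rightarrow> real^2" where
  "triangle_curve \<psi> \<Psi> A B C t =
     (if \<Psi> t $ 1 = \<Psi> t $ 2 \<and> \<Psi> t $ 2 = \<Psi> t $ 3 then centroid A B C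
      else center_of \<psi> (vertex_A \<Psi> A B C t) (vertex_B \<Psi> A B C t) (vertex_C \<Psi> A B C t))"

definition curve_defined ::
  "center_fun \<Rightarrow> (real \<Rightarrow> real^3) \<Rightarrow> real^2 \<Rightarrow> real^2 \<Rightarrow> real^2 \<Rightarrow> real \<Rightarrow> bool" where
  "curve_defined \<psi> \<Psi> A B C t \<longleftrightarrow>
     (\<Psi> t $ 1 = \<Psi> t $ 2 \<and> \<Psi> t $ 2 = \<Psi> t $ 3) \<or>
     center_defined \<psi> (vertex_A \<Psi> A B C t) (vertex_B \<Psi> A B C t) (vertex_C \<Psi> A B C t)"


section \<open>Semi-invariance and invariance\<close>

definition admissible_triangle :: "real^2 \<Rightarrow> real^2 \<Rightarrow> real^2 \<Rightarrow> bool" where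
  "admissible_triangle A B C \<longleftrightarrow>
     \<not> collinear {A, B, C} \<and> \<not> (dist B C = dist C A \<and> dist C A = dist A B)"

inductive similarity_map :: "(real^2 \<Rightarrow> real^2) \<Rightarrow> bool" where
  rotation: "rotation_matrix (Q :: real^2^2) \<Longrightarrow> similarity_map (\<lambda>p. Q *v p)"
| reflection: "n \<noteq> 0 \<Longrightarrow> similarity_map (\<lambda>p. p - (2 * (p \<bullet> n) / (n \<bullet> n)) *\<^sub>R n)"
| scaling: "k \<noteq> 0 \<Longrightarrow> similarity_map (\<lambda>p. k *\<^sub>R p)"
| composition: "similarity_map f \<Longrightarrow> similarity_map g \<Longrightarrow> similarity_map (f \<circ> g)"

definition semi_invariant :: "center_fun \<Rightarrow> (real \<Rightarrow> real^3) \<Rightarrow> bool" where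
  "semi_invariant \<psi> \<Psi> \<longleftrightarrow>
     (\<exists>lx ly :: real \<Rightarrow> real. \<forall>A B C. admissible_triangle A B C \<longrightarrow>
        (\<exists>Vx Vy :: real^2. \<forall>t. curve_defined \<psi> \<Psi> A B C t \<longrightarrow>
           triangle_curve \<psi> \<Psi> A B C t = centroid A B C + lx t *\<^sub>R Vx + ly t *\<^sub>R Vy))"

definition invariant :: "center_fun \<Rightarrow> (real \<Rightarrow> real^3) \<Rightarrow> bool" where
  "invariant \<psi> \<Psi> \<longleftrightarrow>
     (\<exists>lx ly :: real \<Rightarrow> real. \<forall>A B C. admissible_triangle A B C \<longrightarrow>
        (\<exists>Vx Vy :: real^2. similarity_map (\<lambda>p. (p $ 1) *\<^sub>R Vx + (p $ 2) *\<^sub>R Vy) \<and>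
           (\<forall>t. curve_defined \<psi> \<Psi> A B C t \<longrightarrow>
              triangle_curve \<psi> \<Psi> A B C t = centroid A B C + lx t *\<^sub>R Vx + ly t *\<^sub>R Vy)))"


section \<open>Consistency of the conventions\<close>

lemma center_trace_cyclic: "center_trace \<psi> b c a = center_trace \<psi> a b c"
  by (simp add: center_trace_def)

lemma recip_center_eq:
  assumes "\<psi> a b c \<noteq> 0"
  shows "recip_center \<psi> a b c = (\<psi> a b c * \<psi> b c a * \<psi> c a b) * (1 / \<psi> a b c)"
  using assms by (simp add: recip_center_def)

lemma center_trace_recip_center:
  assumes "\<psi> a b c \<noteq> 0" "\<psi> b c a \<noteq> 0" "\<psi> c a b \<noteq> 0"
  shows "center_trace (recip_center \<psi>) a b c =
           (\<psi> a b c * \<psi> b c a * \<psi> c a b) * center_trace (\<lambda>a b c. 1 / \<psi> a b c) a b c"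
  using assms by (simp add: center_trace_def recip_center_def field_simps)

lemma scaled_center_recip_center:
  assumes "\<psi> a b c \<noteq> 0" "\<psi> b c a \<noteq> 0" "\<psi> c a b \<noteq> 0"
  shows "scaled_center (recip_center \<psi>) \<sigma> a b c =
           scaled_center (\<lambda>a b c. 1 / \<psi> a b c) \<sigma> a b c"
  using assms
  by (simp add: scaled_center_def center_trace_recip_center[of \<psi> a b c] recip_center_eq)

lemma center_of_recip_center:
  fixes A B C :: "real^2"
  defines "a \<equiv> dist B C" and "b \<equiv> dist C A" and "c \<equiv> dist A B"
  assumes nz: "\<psi> a b c \<noteq> 0" "\<psi> b c a \<noteq> 0" "\<psi> c a b \<noteq> 0"
  shows "center_of (recip_center \<psi>) A B C = center_of (\<lambda>a b c. 1 / \<psi> a b c) A B C"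
proof -
  have "center_of (recip_center \<psi>) A B C = (1 / center_trace (recip_center \<psi>) a b c) *\<^sub>R
          ((\<psi> a b c * \<psi> b c a * \<psi> c a b) *\<^sub>R
            ((a * (1 / \<psi> a b c)) *\<^sub>R A + (b * (1 / \<psi> b c a)) *\<^sub>R B + (c * (1 / \<psi> c a b)) *\<^sub>R C))"
    using nz by (simp add: center_of_def Let_def a_def b_def c_def recip_center_def
        scaleR_add_right mult_ac)
  also have "\<dots> = center_of (\<lambda>a b c. 1 / \<psi> a b c) A B C"
    using nz by (simp add: center_trace_recip_center center_of_def Let_def a_def b_def c_def)
  finally show ?thesis .
qed

lemma center_trace_phi2:
  assumes "a \<noteq> 0" "b \<noteq> 0" "c \<noteq> 0"
  shows "center_trace phi2 a b c = 3"
  using assms by (simp add: center_trace_def phi2_def)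

lemma mult_scaled_center:
  assumes "center_trace \<psi> a b c \<noteq> 0" "a \<noteq> 0" "b \<noteq> 0" "c \<noteq> 0"
  shows "a * scaled_center \<psi> \<sigma> a b c = (1 - \<sigma>) * (a * \<psi> a b c / center_trace \<psi> a b c) + \<sigma> / 3"
  using assms by (simp add: scaled_center_def center_trace_phi2 phi2_def algebra_simps)

lemma center_trace_scaled_center:
  assumes "a \<noteq> 0" "b \<noteq> 0" "c \<noteq> 0"
  shows "center_trace (scaled_center \<psi> \<sigma>) a b c = (if center_trace \<psi> a b c = 0 then 0 else 1)"
proof (cases "center_trace \<psi> a b c = 0")
  case True
  then show ?thesis
    using center_trace_cyclic[of \<psi> b c a] center_trace_cyclic[of \<psi> c a b]
    by (simp add: center_trace_def[of "scaled_center \<psi> \<sigma>"] scaled_center_def)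
next
  case False
  have cyc: "center_trace \<psi> b c a = center_trace \<psi> a b c" "center_trace \<psi> c a b = center_trace \<psi> a b c"
    using center_trace_cyclic[of \<psi> b c a] center_trace_cyclic[of \<psi> c a b] by simp_all
  have "center_trace (scaled_center \<psi> \<sigma>) a b c =
      (1 - \<sigma>) * ((a * \<psi> a b c + b * \<psi> b c a + c * \<psi> c a b) / center_trace \<psi> a b c) + \<sigma>"
    using assms False cyc
    by (simp add: center_trace_def[of "scaled_center \<psi> \<sigma>"] mult_scaled_center
        add_divide_distrib distrib_left)
  then show ?thesis
    using False by (simp add: center_trace_def[of \<psi>])
qed

lemma center_of_scaled_center:
  fixes A B C :: "real^2"
  assumes "A \<noteq> B" "B \<noteq> C" "C \<noteq> A" and def: "center_defined \<psi> A B C"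
  shows "center_of (scaled_center \<psi> \<sigma>) A B C =
           (1 - \<sigma>) *\<^sub>R center_of \<psi> A B C + \<sigma> *\<^sub>R centroid A B C"
proof -
  define a b c where "a = dist B C" and "b = dist C A" and "c = dist A B"
  note abc = a_def b_def c_def
  have nz: "a \<noteq> 0" "b \<noteq> 0" "c \<noteq> 0" "center_trace \<psi> a b c \<noteq> 0"
    using assms by (auto simp: abc center_defined_def)
  have cyc: "center_trace \<psi> b c a = center_trace \<psi> a b c" "center_trace \<psi> c a b = center_trace \<psi> a b c"
    using center_trace_cyclic[of \<psi> b c a] center_trace_cyclic[of \<psi> c a b] by simp_all
  have "center_of (scaled_center \<psi> \<sigma>) A B C =
      (a * scaled_center \<psi> \<sigma> a b c) *\<^sub>R A + (b * scaled_center \<psi> \<sigma> b c a) *\<^sub>R B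
      + (c * scaled_center \<psi> \<sigma> c a b) *\<^sub>R C"
    using nz unfolding center_of_def Let_def abc[symmetric] by (simp add: center_trace_scaled_center)
  also have "\<dots> = (1 - \<sigma>) *\<^sub>R center_of \<psi> A B C + \<sigma> *\<^sub>R centroid A B C"
    using nz cyc unfolding center_of_def Let_def abc[symmetric] centroid_def
    by (simp add: mult_scaled_center scaleR_add_left scaleR_add_right)
  finally show ?thesis .
qed

lemma area_of_sides_scale:
  assumes "k > 0"
  shows "area_of_sides (k * a) (k * b) (k * c) = k\<^sup>2 * area_of_sides a b c"
proof -
  define s where "s = (a + b + c) / 2"
  have ks: "(k * a + k * b + k * c) / 2 = k * s"
    by (simp add: s_def algebra_simps)
  have "area_of_sides (k * a) (k * b) (k * c) =
      sqrt ((k * s) * (k * s - k * a) * (k * s - k * b) * (k * s - k * c))"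
    using ks by (simp add: area_of_sides_def Let_def)
  also have "\<dots> = sqrt ((k\<^sup>2)\<^sup>2 * (s * (s - a) * (s - b) * (s - c)))"
    by (rule arg_cong[where f = sqrt]) (simp add: power2_eq_square algebra_simps)
  also have "\<dots> = k\<^sup>2 * area_of_sides a b c"
    unfolding real_sqrt_mult[of "(k\<^sup>2)\<^sup>2"] area_of_sides_def Let_def s_def
    by (simp only: real_sqrt_abs abs_power2)
  finally show ?thesis .
qed

lemma psi_Gamma_scale:
  assumes "k > 0"
  shows "psi_Gamma l0 l1 (k * a) (k * b) (k * c) = k ^ 3 * psi_Gamma l0 l1 a b c"
  unfolding psi_Gamma_def area_of_sides_scale[OF assms]
  by (simp add: power2_eq_square power3_eq_cube algebra_simps)

lemma psi_Xi_scale: "psi_Xi l0 l1 (k * a) (k * b) (k * c) = k ^ 3 * psi_Xi l0 l1 a b c"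
  by (simp add: psi_Xi_def power2_eq_square power3_eq_cube algebra_simps)

lemma psi_Gamma_sym: "psi_Gamma l0 l1 a c b = psi_Gamma l0 l1 a b c"
  by (simp add: psi_Gamma_def area_of_sides_def Let_def algebra_simps)

lemma psi_Xi_sym: "psi_Xi l0 l1 a c b = psi_Xi l0 l1 a b c"
  by (simp add: psi_Xi_def algebra_simps)

lemma triangle_center_functionI:
  assumes "triangle_sides x y z" "\<psi> x y z \<noteq> 0"
    and "\<And>a b c k. k > 0 \<Longrightarrow> \<psi> (k * a) (k * b) (k * c) = k ^ n * \<psi> a b c"
    and "\<And>a b c. \<psi> a c b = \<psi> a b c"
  shows "triangle_center_function \<psi>"
  using assms unfolding triangle_center_function_def
  by (metis powr_realpow)

lemma recip_triangle_center_function: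
  assumes "triangle_sides x y z" "\<psi> y z x \<noteq> 0" "\<psi> z x y \<noteq> 0"
    and scale: "\<And>a b c k. k > 0 \<Longrightarrow> \<psi> (k * a) (k * b) (k * c) = k ^ 3 * \<psi> a b c"
    and sym: "\<And>a b c. \<psi> a c b = \<psi> a b c"
  shows "triangle_center_function (recip_center \<psi>)"
proof (rule triangle_center_functionI[where n = 6])
  show "triangle_sides x y z" "recip_center \<psi> x y z \<noteq> 0"
    using assms by (auto simp: recip_center_def)
  show "recip_center \<psi> (k * a) (k * b) (k * c) = k ^ 6 * recip_center \<psi> a b c"
    if "k > 0" for a b c k
    using that by (simp add: recip_center_def scale power_add[of k 3 3, simplified])
  show "recip_center \<psi> a c b = recip_center \<psi> a b c" for a b c
    using sym[of c b a] sym[of b a c] by (simp add: recip_center_def mult.commute)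
qed

lemma psi_Gamma_nonzero:
  assumes "(l0, l1) \<noteq> (0, 0)"
  shows "\<exists>x y. triangle_sides x y y \<and> psi_Gamma l0 l1 y y x \<noteq> 0"
proof (rule ccontr)
  assume neg: "\<not> ?thesis"
  have "triangle_sides 1 1 1" "triangle_sides 6 5 5"
    by (simp_all add: triangle_sides_def)
  with neg have "psi_Gamma l0 l1 1 1 1 = 0" "psi_Gamma l0 l1 5 5 6 = 0"
    by blast+
  moreover have "area_of_sides 1 1 1 = sqrt 3 / 4"
    by (simp add: area_of_sides_def Let_def real_sqrt_divide flip: real_sqrt_eq_iff)
  moreover have "area_of_sides 5 5 6 = 12"
    by (simp add: area_of_sides_def Let_def real_sqrt_unique)
  ultimately have "sqrt 3 * (l0 + l1) = 0" and e: "sqrt 3 * 180 * l0 + 240 * l1 = 0"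
    by (simp_all add: psi_Gamma_def algebra_simps)
  then have "l1 = - l0"
    by simp
  with e have "(sqrt 3 * 180 - 240) * l0 = 0"
    by (simp add: algebra_simps)
  moreover have "sqrt 3 * 180 \<noteq> 240"
  proof
    assume "sqrt 3 * 180 = 240"
    then have "sqrt 3 = 4 / 3" by simp
    then have "(sqrt 3)\<^sup>2 = (4 / 3)\<^sup>2" by (rule arg_cong)
    then show False by (simp add: power2_eq_square)
  qed
  ultimately have "l0 = 0" by simp
  with \<open>l1 = - l0\<close> assms show False by simp
qed

lemma psi_Xi_nonzero:
  assumes "(l0, l1) \<noteq> (0, 0)"
  shows "\<exists>x y. triangle_sides x y y \<and> psi_Xi l0 l1 y y x \<noteq> 0"
proof (rule ccontr)
  assume neg: "\<not> ?thesis"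
  have "triangle_sides 1 1 1" "triangle_sides 1 2 2"
    by (simp_all add: triangle_sides_def)
  with neg have "psi_Xi l0 l1 1 1 1 = 0" "psi_Xi l0 l1 2 2 1 = 0"
    by blast+
  then show False
    using assms by (simp add: psi_Xi_def)
qed

lemma Omega_triangle_center_function:
  assumes "\<psi> \<in> Omega"
  shows "triangle_center_function \<psi>"
proof -
  have cyc: "triangle_sides y y x" if "triangle_sides x y y" for x y
    using that by (simp add: triangle_sides_def)
  have G: "triangle_center_function (psi_Gamma l0 l1) \<and>
           triangle_center_function (recip_center (psi_Gamma l0 l1))"
    if nz: "(l0, l1) \<noteq> (0, 0)" for l0 l1
  proof -
    obtain x y where xy: "triangle_sides x y y" "psi_Gamma l0 l1 y y x \<noteq> 0"
      using psi_Gamma_nonzero[OF nz] by blast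
    moreover have "psi_Gamma l0 l1 y x y \<noteq> 0"
      using xy psi_Gamma_sym[of l0 l1 y x y] by simp
    ultimately show ?thesis
      using triangle_center_functionI[OF cyc, of x y "psi_Gamma l0 l1" 3]
        recip_triangle_center_function[of x y y "psi_Gamma l0 l1"]
        psi_Gamma_scale psi_Gamma_sym by simp
  qed
  have X: "triangle_center_function (psi_Xi l0 l1) \<and>
           triangle_center_function (recip_center (psi_Xi l0 l1))"
    if nz: "(l0, l1) \<noteq> (0, 0)" for l0 l1
  proof -
    obtain x y where xy: "triangle_sides x y y" "psi_Xi l0 l1 y y x \<noteq> 0"
      using psi_Xi_nonzero[OF nz] by blast
    moreover have "psi_Xi l0 l1 y x y \<noteq> 0"
      using xy psi_Xi_sym[of l0 l1 y x y] by simp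
    ultimately show ?thesis
      using triangle_center_functionI[OF cyc, of x y "psi_Xi l0 l1" 3]
        recip_triangle_center_function[of x y y "psi_Xi l0 l1"]
        psi_Xi_scale psi_Xi_sym by simp
  qed
  show ?thesis
    using assms G X by (auto simp: Omega_def Gamma_set_def Xi_set_def)
qed

end

theory Submission
  imports Defs
begin

text \<open>
  In the complex plane, the discrete Fourier transform of length three writes the vertices of any
  triangle as
  \<open>A = g + p + q\<close>, \<open>B = g + \<omega> p + \<omega>\<^sup>2 q\<close>, \<open>C = g + \<omega>\<^sup>2 p + \<omega> q\<close>, where \<open>\<omega>\<close> is a primitive third
  root of unity and \<open>g\<close> is the centroid.  The vertices of a triangle family are cyclic convolutions
  of \<open>(A, B, C)\<close> with \<open>\<Psi> t\<close>, so the transform diagonalises the family: \<open>g\<close> is fixed, and \<open>p\<close>, \<open>q\<close>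
  become \<open>\<mu> p\<close>, \<open>cnj \<mu> q\<close> for one complex number \<open>\<mu>\<close> that depends on \<open>\<Psi> t\<close> only.

  The squared sides are \<open>3 \<bar>p - \<zeta> q\<bar>\<^sup>2\<close> with \<open>\<zeta>\<close> a third root of unity, and the area is
  \<open>3 \<surd>3 / 4 \<cdot> \<bar>P - Q\<bar>\<close> with \<open>P = \<bar>p\<bar>\<^sup>2\<close> and \<open>Q = \<bar>q\<bar>\<^sup>2\<close>.  Every function in \<open>\<Gamma>\<close> and \<open>\<Xi>\<close> has the form
  \<open>a (\<kappa> + l a\<^sup>2)\<close> with \<open>\<kappa>\<close> symmetric in the sides.  Up to a common factor, the barycentric weights
  of the corresponding centers, and of the reciprocal ones, are therefore real combinations
  \<open>\<alpha> + \<beta> \<cdot> 2 Re (cnj \<zeta> z) + \<gamma> \<cdot> 2 Re (\<zeta> z\<^sup>2)\<close> with \<open>z = p (cnj q)\<close>, where \<open>\<alpha>\<close>, \<open>\<beta>\<close>, \<open>\<gamma>\<close> are homogeneous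
  functions of \<open>(P, Q)\<close> of degrees 2, 1, 0.  Summing over the vertices leaves
  \<open>g + U (p\<^sup>2 (cnj q)) + V (q\<^sup>2 (cnj p))\<close>, where \<open>U\<close> and \<open>V\<close> are real and homogeneous of degree
  -1 in \<open>(P, Q)\<close>; this is the predicate \<open>cubic_center\<close> below.

  Passing from \<open>(p, q)\<close> to \<open>(\<mu> p, cnj \<mu> q)\<close> multiplies \<open>E = U (p\<^sup>2 (cnj q))\<close> by \<open>w = \<mu>\<^sup>3 / \<bar>\<mu>\<bar>\<^sup>2\<close> and
  \<open>F = V (q\<^sup>2 (cnj p))\<close> by \<open>cnj w\<close>.  The curve is thus \<open>g + w E + cnj w F\<close>, which is semi-invariant
  because \<open>w\<close> depends on \<open>\<Psi> t\<close> only.  The real linear map \<open>w \<mapsto> w E + cnj w F\<close> is a similarity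
  when exactly one of \<open>E\<close> and \<open>F\<close> vanishes, and this is what happens for the four centers
  \<open>X\<^sub>1\<^sub>3\<close>, \<open>X\<^sub>1\<^sub>4\<close>, \<open>X\<^sub>1\<^sub>5\<close>, \<open>X\<^sub>1\<^sub>6\<close>.  Scaling by \<open>\<sigma>\<close> only multiplies the curve by \<open>1 - \<sigma>\<close> about the centroid.
\<close>

section \<open>Fourier coordinates of a triangle\<close>

definition omega :: complex where
  "omega = Complex (- 1 / 2) (sqrt 3 / 2)"

lemma omega_square: "omega\<^sup>2 = - 1 - omega"
  by (simp add: omega_def complex_eq_iff power2_eq_square)

lemma cnj_omega: "cnj omega = - 1 - omega"
  by (simp add: omega_def complex_eq_iff)

lemma cmod_omega: "cmod omega = 1"
  by (simp add: omega_def cmod_def power2_eq_square)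

definition point :: "complex \<Rightarrow> real^2" where
  "point z = vector [Re z, Im z]"

lemma point_nth [simp]: "point z $ 1 = Re z" "point z $ 2 = Im z"
  by (simp_all add: point_def)

lemma point_add: "point (x + y) = point x + point y"
  by (simp add: vec_eq_iff forall_2)

lemma point_scaleR: "point (r *\<^sub>R x) = r *\<^sub>R point x"
  by (simp add: vec_eq_iff forall_2)

lemma dist_point: "dist (point x) (point y) = cmod (x - y)"
  by (simp add: dist_vec_def L2_set_def sum_2 cmod_def dist_real_def)

lemma surj_point: "\<exists>z. A = point z"
  by (rule exI[of _ "Complex (A $ 1) (A $ 2)"]) (simp add: vec_eq_iff forall_2)

definition fourier_vertex :: "complex \<Rightarrow> complex \<Rightarrow> complex \<Rightarrow> complex \<Rightarrow> real^2" where
  "fourier_vertex g p q \<zeta> = point (g + \<zeta> * p + cnj \<zeta> * q)"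

lemma triangle_fourier:
  obtains g p q where "A = fourier_vertex g p q 1"
    "B = fourier_vertex g p q omega" "C = fourier_vertex g p q (cnj omega)"
proof -
  obtain x y z where xyz: "A = point x" "B = point y" "C = point z"
    using surj_point by metis
  define g where "g = (x + y + z) / 3"
  define p where "p = (x + cnj omega * y + omega * z) / 3"
  define q where "q = (x + omega * y + cnj omega * z) / 3"
  have "x = g + p + q"
    unfolding g_def p_def q_def cnj_omega by (simp add: field_simps)
  moreover have "y = g + omega * p + cnj omega * q"
    unfolding g_def p_def q_def cnj_omega using omega_square by (simp add: field_simps) algebra
  moreover have "z = g + cnj omega * p + omega * q"
    unfolding g_def p_def q_def cnj_omega using omega_square by (simp add: field_simps) algebra
  ultimately show ?thesis
    using xyz by (intro that[of g p q]) (simp_all add: fourier_vertex_def)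
qed

lemma centroid_fourier:
  "centroid (fourier_vertex g p q 1) (fourier_vertex g p q omega)
     (fourier_vertex g p q (cnj omega)) = point g"
  by (simp add: centroid_def fourier_vertex_def cnj_omega flip: point_add point_scaleR)
     (simp add: algebra_simps scaleR_conv_of_real)

text \<open>
  The length of the side opposite the vertex that belongs to the third root of unity \<open>\<zeta>\<close>.
\<close>

definition opposite_side :: "complex \<Rightarrow> complex \<Rightarrow> complex \<Rightarrow> real" where
  "opposite_side p q \<zeta> = sqrt 3 * cmod (p - \<zeta> * q)"

lemma dist_fourier:
  "dist (fourier_vertex g p q omega) (fourier_vertex g p q (cnj omega)) = opposite_side p q 1"
  "dist (fourier_vertex g p q (cnj omega)) (fourier_vertex g p q 1) = opposite_side p q omega"
  "dist (fourier_vertex g p q 1) (fourier_vertex g p q omega) = opposite_side p q (cnj omega)"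
proof -
  \<comment> \<open>Each side is the difference \<open>omega - cnj omega\<close> times \<open>p - \<zeta> q\<close>, rotated by \<open>\<zeta>\<close>.\<close>
  have n: "cmod (omega - cnj omega) = sqrt 3"
    by (simp add: omega_def cmod_def)
  have u: "cmod (cnj omega) = 1"
    by (simp add: cmod_omega)
  have "g + omega * p + cnj omega * q - (g + cnj omega * p + omega * q) =
      (omega - cnj omega) * (p - 1 * q)"
    by (simp add: algebra_simps)
  then show "dist (fourier_vertex g p q omega) (fourier_vertex g p q (cnj omega)) =
      opposite_side p q 1"
    by (simp add: dist_point fourier_vertex_def opposite_side_def norm_mult n)
  have "g + cnj omega * p + omega * q - (g + 1 * p + 1 * q) =
      omega * ((omega - cnj omega) * (p - omega * q))"
    unfolding cnj_omega using omega_square by algebra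
  then show "dist (fourier_vertex g p q (cnj omega)) (fourier_vertex g p q 1) =
      opposite_side p q omega"
    by (simp add: dist_point fourier_vertex_def opposite_side_def norm_mult n cmod_omega)
  have "g + 1 * p + 1 * q - (g + omega * p + cnj omega * q) =
      cnj omega * ((omega - cnj omega) * (p - cnj omega * q))"
    unfolding cnj_omega using omega_square by algebra
  then show "dist (fourier_vertex g p q 1) (fourier_vertex g p q omega) =
      opposite_side p q (cnj omega)"
    by (simp add: dist_point fourier_vertex_def opposite_side_def norm_mult n u del: complex_mod_cnj)
qed

lemma opposite_side_square:
  assumes "cmod \<zeta> = 1"
  shows "(opposite_side p q \<zeta>)\<^sup>2 =
           3 * ((cmod p)\<^sup>2 + (cmod q)\<^sup>2 - 2 * Re (cnj \<zeta> * (p * cnj q)))"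
proof -
  have "(cmod (p - \<zeta> * q))\<^sup>2 = (cmod p)\<^sup>2 + (cmod (\<zeta> * q))\<^sup>2 - 2 * Re (p * cnj (\<zeta> * q))"
    unfolding cmod_power2 by (simp add: algebra_simps power2_eq_square)
  then show ?thesis
    using assms by (simp add: opposite_side_def power_mult_distrib norm_mult mult_ac)
qed

lemma norm_product_square: "(Re (p * cnj q))\<^sup>2 + (Im (p * cnj q))\<^sup>2 = (cmod p)\<^sup>2 * (cmod q)\<^sup>2"
  by (simp only: norm_mult complex_mod_cnj power_mult_distrib flip: cmod_power2)

lemma twice_Re_rotated:
  "2 * Re (cnj 1 * z) = 2 * Re z"
  "2 * Re (cnj omega * z) = - Re z + sqrt 3 * Im z"
  "2 * Re (cnj (cnj omega) * z) = - Re z - sqrt 3 * Im z"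
  by (simp_all add: omega_def algebra_simps)

lemma opposite_side_squares:
  "(opposite_side p q 1)\<^sup>2 = 3 * ((cmod p)\<^sup>2 + (cmod q)\<^sup>2 - 2 * Re (p * cnj q))"
  "(opposite_side p q omega)\<^sup>2 =
     3 * ((cmod p)\<^sup>2 + (cmod q)\<^sup>2 + Re (p * cnj q) - sqrt 3 * Im (p * cnj q))"
  "(opposite_side p q (cnj omega))\<^sup>2 =
     3 * ((cmod p)\<^sup>2 + (cmod q)\<^sup>2 + Re (p * cnj q) + sqrt 3 * Im (p * cnj q))"
  using opposite_side_square[of 1 p q] opposite_side_square[of omega p q]
    opposite_side_square[of "cnj omega" p q] twice_Re_rotated[of "p * cnj q"]
  by (simp_all add: cmod_omega)

lemma sum_side_squares:
  "(opposite_side p q 1)\<^sup>2 + (opposite_side p q omega)\<^sup>2 + (opposite_side p q (cnj omega))\<^sup>2 =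
     9 * ((cmod p)\<^sup>2 + (cmod q)\<^sup>2)"
  by (simp add: opposite_side_squares)

text \<open>
  The quantity \<open>P - Q\<close> is proportional to the signed area.  Since the area itself is
  nonnegative, the sign with which \<open>P - Q\<close> enters a center depends on the orientation.
\<close>

lemma area_fourier:
  "area_of_sides (opposite_side p q 1) (opposite_side p q omega) (opposite_side p q (cnj omega)) =
     3 * sqrt 3 / 4 * \<bar>(cmod p)\<^sup>2 - (cmod q)\<^sup>2\<bar>"
proof -
  define a b c where "a = opposite_side p q 1" and "b = opposite_side p q omega"
    and "c = opposite_side p q (cnj omega)"
  define P Q x y where "P = (cmod p)\<^sup>2" and "Q = (cmod q)\<^sup>2"
    and "x = Re (p * cnj q)" and "y = Im (p * cnj q)"
  have sq: "a\<^sup>2 = 3 * (P + Q - 2 * x)" "b\<^sup>2 = 3 * (P + Q + x - sqrt 3 * y)"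
    "c\<^sup>2 = 3 * (P + Q + x + sqrt 3 * y)" and PQ: "x\<^sup>2 + y\<^sup>2 = P * Q"
    by (simp_all only: a_def b_def c_def P_def Q_def x_def y_def opposite_side_squares
        norm_product_square)
  have s3: "(sqrt 3)\<^sup>2 = (3::real)" by simp
  have "16 * ((a + b + c) / 2 * ((a + b + c) / 2 - a) * ((a + b + c) / 2 - b) * ((a + b + c) / 2 - c))
      = 2 * (a\<^sup>2 * b\<^sup>2 + b\<^sup>2 * c\<^sup>2 + c\<^sup>2 * a\<^sup>2) - (a\<^sup>2 * a\<^sup>2 + b\<^sup>2 * b\<^sup>2 + c\<^sup>2 * c\<^sup>2)"
    by (simp add: field_simps) algebra
  also have "\<dots> = 27 * (P - Q)\<^sup>2"
    unfolding sq using PQ s3 by algebra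
  finally have "(a + b + c) / 2 * ((a + b + c) / 2 - a) * ((a + b + c) / 2 - b) * ((a + b + c) / 2 - c)
      = (3 * sqrt 3 / 4 * \<bar>P - Q\<bar>)\<^sup>2"
    by (simp add: power_mult_distrib power_divide)
  then show ?thesis
    unfolding area_of_sides_def Let_def a_def[symmetric] b_def[symmetric] c_def[symmetric]
      P_def[symmetric] Q_def[symmetric] by simp
qed

text \<open>
  When \<open>\<bar>p\<bar> = \<bar>q\<bar>\<close> the area is zero, so some factor in Heron's formula vanishes.  This is a case of
  equality in the triangle inequality.
\<close>

lemma collinear_fourier:
  assumes "cmod p = cmod q"
  shows "collinear {fourier_vertex g p q 1, fourier_vertex g p q omega,
                    fourier_vertex g p q (cnj omega)}"
proof -
  let ?A = "fourier_vertex g p q 1" and ?B = "fourier_vertex g p q omega"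
    and ?C = "fourier_vertex g p q (cnj omega)"
  let ?s = "(dist ?B ?C + dist ?C ?A + dist ?A ?B) / 2"
  have "area_of_sides (dist ?B ?C) (dist ?C ?A) (dist ?A ?B) = 0"
    unfolding dist_fourier area_fourier using assms by simp
  then have "?s = 0 \<or> ?s = dist ?B ?C \<or> ?s = dist ?C ?A \<or> ?s = dist ?A ?B"
    by (simp add: area_of_sides_def Let_def)
  moreover have "dist ?B ?C \<ge> 0" "dist ?C ?A \<ge> 0" "dist ?A ?B \<ge> 0"
    "dist ?B ?C \<le> dist ?C ?A + dist ?A ?B" "dist ?C ?A \<le> dist ?A ?B + dist ?B ?C"
    "dist ?A ?B \<le> dist ?B ?C + dist ?C ?A"
    using dist_triangle[of ?B ?C ?A] dist_triangle[of ?C ?A ?B] dist_triangle[of ?A ?B ?C]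
    by (simp_all add: dist_commute)
  ultimately have "dist ?B ?C = dist ?B ?A + dist ?A ?C \<or> dist ?C ?A = dist ?C ?B + dist ?B ?A \<or>
      dist ?A ?B = dist ?A ?C + dist ?C ?B"
    by (simp add: dist_commute) argo
  then show ?thesis
    unfolding collinear_between_cases between by blast
qed

text \<open>
  The triangle is equilateral if \<open>p = 0\<close> or \<open>q = 0\<close>, since then the factors \<open>\<bar>p - \<zeta> q\<bar>\<close> agree.
\<close>

lemma admissible_fourier:
  assumes "admissible_triangle (fourier_vertex g p q 1) (fourier_vertex g p q omega)
             (fourier_vertex g p q (cnj omega))"
  shows "cmod p \<noteq> cmod q" "p \<noteq> 0" "q \<noteq> 0"
  using assms collinear_fourier[of p q g]
  by (auto simp: admissible_triangle_def dist_fourier opposite_side_def norm_mult cmod_omega)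

section \<open>Centers in Fourier coordinates\<close>

text \<open>
  The homogeneity of \<open>U\<close> and \<open>V\<close> is part of the notion because a triangle family scales
  \<open>(\<bar>p\<bar>\<^sup>2, \<bar>q\<bar>\<^sup>2)\<close> by a common factor.
\<close>

definition cubic_center :: "center_fun \<Rightarrow> (real \<Rightarrow> real \<Rightarrow> real) \<Rightarrow> (real \<Rightarrow> real \<Rightarrow> real) \<Rightarrow> bool" where
  "cubic_center \<psi> U V \<longleftrightarrow>
     (\<forall>g p q. cmod p \<noteq> cmod q \<longrightarrow>
        center_defined \<psi> (fourier_vertex g p q 1) (fourier_vertex g p q omega)
          (fourier_vertex g p q (cnj omega)) \<longrightarrow>
        center_of \<psi> (fourier_vertex g p q 1) (fourier_vertex g p q omega)
          (fourier_vertex g p q (cnj omega)) =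
        point (g + of_real (U ((cmod p)\<^sup>2) ((cmod q)\<^sup>2)) * (p\<^sup>2 * cnj q)
                 + of_real (V ((cmod p)\<^sup>2) ((cmod q)\<^sup>2)) * (q\<^sup>2 * cnj p))) \<and>
     (\<forall>m P Q. m > 0 \<longrightarrow> U (m * P) (m * Q) = U P Q / m \<and> V (m * P) (m * Q) = V P Q / m)"

text \<open>
  The Fourier expansion of a real weight at the vertex \<open>\<zeta>\<close>.  The two harmonics carry opposite
  powers of \<open>\<zeta>\<close> because \<open>\<zeta>\<^sup>-\<^sup>2 = \<zeta>\<close> for third roots of unity.
\<close>

definition harmonic_weight :: "real \<Rightarrow> real \<Rightarrow> real \<Rightarrow> complex \<Rightarrow> complex \<Rightarrow> real" where
  "harmonic_weight \<alpha> \<beta> \<gamma> z \<zeta> = \<alpha> + \<beta> * (2 * Re (cnj \<zeta> * z)) + \<gamma> * (2 * Re (\<zeta> * z\<^sup>2))"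

lemma harmonic_weight_sum:
  "harmonic_weight \<alpha> \<beta> \<gamma> z 1 + harmonic_weight \<alpha> \<beta> \<gamma> z omega
     + harmonic_weight \<alpha> \<beta> \<gamma> z (cnj omega) = 3 * \<alpha>"
  by (simp add: harmonic_weight_def omega_def algebra_simps)

lemma harmonic_weight_complex:
  "complex_of_real (harmonic_weight \<alpha> \<beta> \<gamma> z \<zeta>) =
     of_real \<alpha> + of_real \<beta> * (cnj \<zeta> * z + \<zeta> * cnj z) + of_real \<gamma> * (\<zeta> * z\<^sup>2 + cnj \<zeta> * (cnj z)\<^sup>2)"
  using complex_add_cnj[of "cnj \<zeta> * z"] complex_add_cnj[of "\<zeta> * z\<^sup>2"]
  by (simp add: harmonic_weight_def)

text \<open>
  By orthogonality of the characters of the cyclic group of order three, \<open>\<alpha>\<close> meets only \<open>g\<close>, and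
  the coefficient of \<open>p\<close> picks out \<open>\<beta> z\<close> and \<open>\<gamma> (cnj z)\<^sup>2\<close>.  As \<open>p (cnj z)\<^sup>2 = \<bar>p\<bar>\<^sup>2 q\<^sup>2 (cnj p)\<close>, the
  quintic terms reduce to the same two cubic monomials as the terms with \<open>\<beta>\<close>.
\<close>

lemma harmonic_weighted_sum:
  fixes g p q :: complex and \<alpha> \<beta> \<gamma> :: real
  defines "w \<equiv> \<lambda>\<zeta>. complex_of_real (harmonic_weight \<alpha> \<beta> \<gamma> (p * cnj q) \<zeta>)"
  shows "w 1 * (g + p + q) + w omega * (g + omega * p + cnj omega * q)
           + w (cnj omega) * (g + cnj omega * p + omega * q) =
         3 * (of_real \<alpha> * g + of_real (\<beta> + \<gamma> * (cmod q)\<^sup>2) * (p\<^sup>2 * cnj q)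
           + of_real (\<beta> + \<gamma> * (cmod p)\<^sup>2) * (q\<^sup>2 * cnj p))"
proof -
  have P: "complex_of_real ((cmod p)\<^sup>2) = p * cnj p" "complex_of_real ((cmod q)\<^sup>2) = q * cnj q"
    by (simp_all only: complex_norm_square)
  show ?thesis
    unfolding w_def harmonic_weight_complex of_real_add of_real_mult P
    unfolding complex_cnj_mult complex_cnj_diff complex_cnj_minus complex_cnj_cnj complex_cnj_one
      cnj_omega
    using omega_square by algebra
qed

text \<open>
  The common factor \<open>k\<close> of the weights cancels against the trace; for reciprocal functions it is
  the product of the sides.
\<close>

lemma center_of_harmonic:
  fixes g p q :: complex and \<alpha> \<beta> \<gamma> :: real
  defines "a \<equiv> opposite_side p q 1" and "b \<equiv> opposite_side p q omega"
    and "c \<equiv> opposite_side p q (cnj omega)"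
    and "w \<equiv> harmonic_weight \<alpha> \<beta> \<gamma> (p * cnj q)"
  assumes w: "a * \<psi> a b c = k * w 1" "b * \<psi> b c a = k * w omega" "c * \<psi> c a b = k * w (cnj omega)"
    and def: "center_defined \<psi> (fourier_vertex g p q 1) (fourier_vertex g p q omega)
      (fourier_vertex g p q (cnj omega))"
  shows "center_of \<psi> (fourier_vertex g p q 1) (fourier_vertex g p q omega)
           (fourier_vertex g p q (cnj omega)) =
         point (g + of_real ((\<beta> + \<gamma> * (cmod q)\<^sup>2) / \<alpha>) * (p\<^sup>2 * cnj q)
           + of_real ((\<beta> + \<gamma> * (cmod p)\<^sup>2) / \<alpha>) * (q\<^sup>2 * cnj p))"
proof -
  have "center_trace \<psi> a b c = k * (w 1 + w omega + w (cnj omega))"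
    by (simp add: center_trace_def w algebra_simps)
  then have tr: "center_trace \<psi> a b c = k * (3 * \<alpha>)"
    by (simp add: w_def harmonic_weight_sum)
  moreover have "center_trace \<psi> a b c \<noteq> 0"
    using def by (simp add: center_defined_def dist_fourier a_def b_def c_def)
  ultimately have nz: "k \<noteq> 0" "\<alpha> \<noteq> 0" by auto
  define X Y Z where "X = g + p + q" and "Y = g + omega * p + cnj omega * q"
    and "Z = g + cnj omega * p + omega * q"
  have vertices: "fourier_vertex g p q 1 = point X" "fourier_vertex g p q omega = point Y"
    "fourier_vertex g p q (cnj omega) = point Z"
    by (simp_all add: fourier_vertex_def X_def Y_def Z_def)
  have "center_of \<psi> (fourier_vertex g p q 1) (fourier_vertex g p q omega)
      (fourier_vertex g p q (cnj omega)) =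
      (1 / (k * (3 * \<alpha>))) *\<^sub>R ((k * w 1) *\<^sub>R point X + (k * w omega) *\<^sub>R point Y
        + (k * w (cnj omega)) *\<^sub>R point Z)"
    unfolding center_of_def Let_def dist_fourier a_def[symmetric] b_def[symmetric] c_def[symmetric]
      tr w unfolding vertices ..
  also have "\<dots> = point ((1 / (3 * \<alpha>)) *\<^sub>R
      (complex_of_real (w 1) * X + complex_of_real (w omega) * Y
        + complex_of_real (w (cnj omega)) * Z))"
    unfolding scaleR_conv_of_real[symmetric] point_scaleR point_add
    using nz by (simp add: scaleR_add_right)
  also have "(1 / (3 * \<alpha>)) *\<^sub>R (complex_of_real (w 1) * X + complex_of_real (w omega) * Y
        + complex_of_real (w (cnj omega)) * Z) =
      g + of_real ((\<beta> + \<gamma> * (cmod q)\<^sup>2) / \<alpha>) * (p\<^sup>2 * cnj q)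
        + of_real ((\<beta> + \<gamma> * (cmod p)\<^sup>2) / \<alpha>) * (q\<^sup>2 * cnj p)"
    unfolding w_def X_def Y_def Z_def harmonic_weighted_sum
    using nz by (simp add: scaleR_conv_of_real field_simps)
  finally show ?thesis .
qed

text \<open>
  With \<open>\<alpha>\<close>, \<open>\<beta>\<close>, \<open>\<gamma>\<close> homogeneous of degrees 2, 1, 0, the quotients have degree -1.
\<close>

lemma cubic_centerI:
  fixes \<alpha> \<beta> :: "real \<Rightarrow> real \<Rightarrow> real" and \<gamma> :: real
  assumes weight: "\<And>p q. \<exists>k.
      let a = opposite_side p q 1; b = opposite_side p q omega; c = opposite_side p q (cnj omega);
        P = (cmod p)\<^sup>2; Q = (cmod q)\<^sup>2;
        w = harmonic_weight (\<alpha> P Q) (\<beta> P Q) \<gamma> (p * cnj q)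
      in a * \<psi> a b c = k * w 1 \<and> b * \<psi> b c a = k * w omega \<and> c * \<psi> c a b = k * w (cnj omega)"
    and \<alpha>: "\<And>m P Q. m > 0 \<Longrightarrow> \<alpha> (m * P) (m * Q) = m\<^sup>2 * \<alpha> P Q"
    and \<beta>: "\<And>m P Q. m > 0 \<Longrightarrow> \<beta> (m * P) (m * Q) = m * \<beta> P Q"
  shows "cubic_center \<psi> (\<lambda>P Q. (\<beta> P Q + \<gamma> * Q) / \<alpha> P Q) (\<lambda>P Q. (\<beta> P Q + \<gamma> * P) / \<alpha> P Q)"
  unfolding cubic_center_def
proof (intro conjI allI impI)
  fix g p q :: complex
  assume def: "center_defined \<psi> (fourier_vertex g p q 1)
    (fourier_vertex g p q omega) (fourier_vertex g p q (cnj omega))"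
  from weight[of p q, unfolded Let_def] obtain k where w:
    "opposite_side p q 1 * \<psi> (opposite_side p q 1) (opposite_side p q omega)
        (opposite_side p q (cnj omega)) =
      k * harmonic_weight (\<alpha> ((cmod p)\<^sup>2) ((cmod q)\<^sup>2)) (\<beta> ((cmod p)\<^sup>2) ((cmod q)\<^sup>2)) \<gamma> (p * cnj q) 1"
    "opposite_side p q omega * \<psi> (opposite_side p q omega) (opposite_side p q (cnj omega))
        (opposite_side p q 1) =
      k * harmonic_weight (\<alpha> ((cmod p)\<^sup>2) ((cmod q)\<^sup>2)) (\<beta> ((cmod p)\<^sup>2) ((cmod q)\<^sup>2)) \<gamma> (p * cnj q) omega"
    "opposite_side p q (cnj omega) * \<psi> (opposite_side p q (cnj omega)) (opposite_side p q 1)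
        (opposite_side p q omega) =
      k * harmonic_weight (\<alpha> ((cmod p)\<^sup>2) ((cmod q)\<^sup>2)) (\<beta> ((cmod p)\<^sup>2) ((cmod q)\<^sup>2)) \<gamma> (p * cnj q) (cnj omega)"
    by blast
  show "center_of \<psi> (fourier_vertex g p q 1) (fourier_vertex g p q omega)
      (fourier_vertex g p q (cnj omega)) =
      point (g + of_real ((\<beta> ((cmod p)\<^sup>2) ((cmod q)\<^sup>2) + \<gamma> * (cmod q)\<^sup>2) / \<alpha> ((cmod p)\<^sup>2) ((cmod q)\<^sup>2))
          * (p\<^sup>2 * cnj q)
        + of_real ((\<beta> ((cmod p)\<^sup>2) ((cmod q)\<^sup>2) + \<gamma> * (cmod p)\<^sup>2) / \<alpha> ((cmod p)\<^sup>2) ((cmod q)\<^sup>2))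
          * (q\<^sup>2 * cnj p))"
    by (rule center_of_harmonic[OF w def])
next
  fix m P Q :: real
  assume m: "m > 0"
  have "m * b / (m\<^sup>2 * a) = b / a / m" for a b
    using m by (simp add: power2_eq_square)
  moreover have "m * \<beta> P Q + \<gamma> * (m * x) = m * (\<beta> P Q + \<gamma> * x)" for x
    by (simp add: algebra_simps)
  ultimately show "(\<beta> (m * P) (m * Q) + \<gamma> * (m * Q)) / \<alpha> (m * P) (m * Q) =
      (\<beta> P Q + \<gamma> * Q) / \<alpha> P Q / m"
    "(\<beta> (m * P) (m * Q) + \<gamma> * (m * P)) / \<alpha> (m * P) (m * Q) = (\<beta> P Q + \<gamma> * P) / \<alpha> P Q / m"
    by (simp_all only: \<alpha>[OF m] \<beta>[OF m])
qed

section \<open>The functions of the two families and their reciprocals\<close>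

definition quadratic_center :: "real \<Rightarrow> real \<Rightarrow> real \<Rightarrow> center_fun" where
  "quadratic_center k1 k2 l a b c =
     a * (k1 * (a\<^sup>2 + b\<^sup>2 + c\<^sup>2) + k2 * area_of_sides a b c + l * a\<^sup>2)"

lemma psi_Gamma_quadratic:
  "psi_Gamma l0 l1 = quadratic_center (sqrt 3 * l0) (4 * l1) (- 2 * sqrt 3 * l0)"
  by (intro ext) (simp add: psi_Gamma_def quadratic_center_def algebra_simps)

lemma psi_Xi_quadratic: "psi_Xi l0 l1 = quadratic_center (l1 - l0) 0 (2 * l0)"
  by (intro ext) (simp add: psi_Xi_def quadratic_center_def algebra_simps)

text \<open>
  The value of the cyclically symmetric summand \<open>k1 (a\<^sup>2 + b\<^sup>2 + c\<^sup>2) + k2 area\<close> in terms of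
  \<open>P = \<bar>p\<bar>\<^sup>2\<close> and \<open>Q = \<bar>q\<bar>\<^sup>2\<close>.
\<close>

definition symmetric_part :: "real \<Rightarrow> real \<Rightarrow> real \<Rightarrow> real \<Rightarrow> real" where
  "symmetric_part k1 k2 P Q = 9 * k1 * (P + Q) + 3 * sqrt 3 / 4 * k2 * \<bar>P - Q\<bar>"

lemma symmetric_part_scale:
  assumes "m > 0"
  shows "symmetric_part k1 k2 (m * P) (m * Q) = m * symmetric_part k1 k2 P Q"
proof -
  have "\<bar>m * P - m * Q\<bar> = m * \<bar>P - Q\<bar>"
    using assms by (metis abs_mult abs_of_pos right_diff_distrib)
  then show ?thesis
    by (simp add: symmetric_part_def algebra_simps)
qed

lemma area_of_sides_cyclic: "area_of_sides b c a = area_of_sides a b c"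
  by (simp add: area_of_sides_def Let_def algebra_simps)

lemma quadratic_center_fourier:
  fixes p q :: complex and k1 k2 :: real
  defines "a \<equiv> opposite_side p q 1" and "b \<equiv> opposite_side p q omega"
    and "c \<equiv> opposite_side p q (cnj omega)"
    and "\<kappa> \<equiv> symmetric_part k1 k2 ((cmod p)\<^sup>2) ((cmod q)\<^sup>2)"
  shows "quadratic_center k1 k2 l a b c = a * (\<kappa> + l * a\<^sup>2)"
    "quadratic_center k1 k2 l b c a = b * (\<kappa> + l * b\<^sup>2)"
    "quadratic_center k1 k2 l c a b = c * (\<kappa> + l * c\<^sup>2)"
proof -
  have k: "k1 * (a\<^sup>2 + b\<^sup>2 + c\<^sup>2) + k2 * area_of_sides a b c = \<kappa>"
    unfolding \<kappa>_def symmetric_part_def a_def b_def c_def sum_side_squares area_fourier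
    by (simp add: algebra_simps)
  show "quadratic_center k1 k2 l a b c = a * (\<kappa> + l * a\<^sup>2)"
    unfolding k[symmetric] quadratic_center_def by simp
  show "quadratic_center k1 k2 l b c a = b * (\<kappa> + l * b\<^sup>2)"
    unfolding k[symmetric] quadratic_center_def area_of_sides_cyclic[of b c a]
    by (simp add: algebra_simps)
  show "quadratic_center k1 k2 l c a b = c * (\<kappa> + l * c\<^sup>2)"
    unfolding k[symmetric] quadratic_center_def area_of_sides_cyclic[of a b c, symmetric]
      area_of_sides_cyclic[of b c a, symmetric]
    by (simp add: algebra_simps)
qed

lemma harmonic_weights_real:
  "harmonic_weight \<alpha> \<beta> \<gamma> z 1 = \<alpha> + \<beta> * (2 * Re z) + \<gamma> * (2 * ((Re z)\<^sup>2 - (Im z)\<^sup>2))"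
  "harmonic_weight \<alpha> \<beta> \<gamma> z omega = \<alpha> + \<beta> * (sqrt 3 * Im z - Re z)
     + \<gamma> * (- ((Re z)\<^sup>2 - (Im z)\<^sup>2) - 2 * sqrt 3 * (Re z * Im z))"
  "harmonic_weight \<alpha> \<beta> \<gamma> z (cnj omega) = \<alpha> + \<beta> * (- sqrt 3 * Im z - Re z)
     + \<gamma> * (- ((Re z)\<^sup>2 - (Im z)\<^sup>2) + 2 * sqrt 3 * (Re z * Im z))"
  by (simp_all add: harmonic_weight_def omega_def power2_eq_square algebra_simps)

text \<open>
  With \<open>s = P + Q\<close>, \<open>\<tau> = 2 Re (cnj \<zeta> z)\<close> and \<open>a\<^sup>2 = 3 (s - \<tau>)\<close>, the weight
  \<open>a\<^sup>2 (\<kappa> + l a\<^sup>2) = 3 (s - \<tau>) (\<kappa> + 3 l s - 3 l \<tau>)\<close> is quadratic in \<open>\<tau>\<close>, and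
  \<open>\<tau>\<^sup>2 = 2 Re (\<zeta> z\<^sup>2) + 2 P Q\<close> makes it harmonic.
\<close>

lemma cubic_center_quadratic:
  fixes k1 k2 l :: real
  defines "\<alpha> \<equiv> \<lambda>P Q. 3 * (symmetric_part k1 k2 P Q * (P + Q) + 3 * l * (P + Q)\<^sup>2 + 6 * l * P * Q)"
    and "\<beta> \<equiv> \<lambda>P Q. - 3 * (symmetric_part k1 k2 P Q + 6 * l * (P + Q))"
  shows "cubic_center (quadratic_center k1 k2 l)
           (\<lambda>P Q. (\<beta> P Q + 9 * l * Q) / \<alpha> P Q) (\<lambda>P Q. (\<beta> P Q + 9 * l * P) / \<alpha> P Q)"
proof (rule cubic_centerI)
  fix p q :: complex
  define P Q x y where "P = (cmod p)\<^sup>2" and "Q = (cmod q)\<^sup>2"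
    and "x = Re (p * cnj q)" and "y = Im (p * cnj q)"
  define a b c where "a = opposite_side p q 1" and "b = opposite_side p q omega"
    and "c = opposite_side p q (cnj omega)"
  define \<kappa> where "\<kappa> = symmetric_part k1 k2 P Q"
  define w where "w = harmonic_weight (\<alpha> P Q) (\<beta> P Q) (9 * l) (p * cnj q)"
  have sq: "a\<^sup>2 = 3 * (P + Q - 2 * x)" "b\<^sup>2 = 3 * (P + Q + x - sqrt 3 * y)"
    "c\<^sup>2 = 3 * (P + Q + x + sqrt 3 * y)" and PQ: "x\<^sup>2 + y\<^sup>2 = P * Q"
    by (simp_all only: a_def b_def c_def P_def Q_def x_def y_def opposite_side_squares
        norm_product_square)
  have s3: "(sqrt 3)\<^sup>2 = (3::real)" by simp
  have "a\<^sup>2 * (\<kappa> + l * a\<^sup>2) = w 1" "b\<^sup>2 * (\<kappa> + l * b\<^sup>2) = w omega"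
    "c\<^sup>2 * (\<kappa> + l * c\<^sup>2) = w (cnj omega)"
    unfolding sq w_def harmonic_weights_real x_def[symmetric] y_def[symmetric] \<alpha>_def \<beta>_def
      \<kappa>_def[symmetric] using PQ s3 by algebra+
  then have "a * quadratic_center k1 k2 l a b c = 1 * w 1"
    "b * quadratic_center k1 k2 l b c a = 1 * w omega"
    "c * quadratic_center k1 k2 l c a b = 1 * w (cnj omega)"
    unfolding a_def b_def c_def quadratic_center_fourier
    by (simp_all add: \<kappa>_def P_def Q_def power2_eq_square)
  then show "\<exists>k. let a = opposite_side p q 1; b = opposite_side p q omega;
        c = opposite_side p q (cnj omega); P = (cmod p)\<^sup>2; Q = (cmod q)\<^sup>2;
        w = harmonic_weight (\<alpha> P Q) (\<beta> P Q) (9 * l) (p * cnj q)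
      in a * quadratic_center k1 k2 l a b c = k * w 1 \<and> b * quadratic_center k1 k2 l b c a = k * w omega
        \<and> c * quadratic_center k1 k2 l c a b = k * w (cnj omega)"
    unfolding Let_def w_def P_def Q_def a_def b_def c_def by blast
next
  fix m P Q :: real
  assume m: "m > 0"
  show "\<alpha> (m * P) (m * Q) = m\<^sup>2 * \<alpha> P Q" "\<beta> (m * P) (m * Q) = m * \<beta> P Q"
    unfolding \<alpha>_def \<beta>_def symmetric_part_scale[OF m]
    by (simp_all add: power2_eq_square algebra_simps)
qed

text \<open>
  The weight at one vertex is \<open>a b c\<close> times the product of the factors \<open>h - 3 l \<tau>\<close> at the two other
  vertices.  There the numbers \<open>\<tau>\<close> sum to \<open>- \<tau>\<close> and have the product \<open>2 Re (\<zeta> z\<^sup>2) - P Q\<close>, where \<open>\<tau>\<close>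
  and \<open>\<zeta>\<close> belong to the first vertex.
\<close>

lemma cubic_center_recip_quadratic:
  fixes k1 k2 l :: real
  defines "h \<equiv> \<lambda>P Q. symmetric_part k1 k2 P Q + 3 * l * (P + Q)"
  defines "\<alpha> \<equiv> \<lambda>P Q. (h P Q)\<^sup>2 - 9 * l\<^sup>2 * (P * Q)"
    and "\<beta> \<equiv> \<lambda>P Q. 3 * l * h P Q"
  shows "cubic_center (recip_center (quadratic_center k1 k2 l))
           (\<lambda>P Q. (\<beta> P Q + 9 * l\<^sup>2 * Q) / \<alpha> P Q) (\<lambda>P Q. (\<beta> P Q + 9 * l\<^sup>2 * P) / \<alpha> P Q)"
proof (rule cubic_centerI)
  fix p q :: complex
  define P Q x y where "P = (cmod p)\<^sup>2" and "Q = (cmod q)\<^sup>2"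
    and "x = Re (p * cnj q)" and "y = Im (p * cnj q)"
  define a b c where "a = opposite_side p q 1" and "b = opposite_side p q omega"
    and "c = opposite_side p q (cnj omega)"
  define \<kappa> where "\<kappa> = symmetric_part k1 k2 P Q"
  define w where "w = harmonic_weight (\<alpha> P Q) (\<beta> P Q) (9 * l\<^sup>2) (p * cnj q)"
  have sq: "a\<^sup>2 = 3 * (P + Q - 2 * x)" "b\<^sup>2 = 3 * (P + Q + x - sqrt 3 * y)"
    "c\<^sup>2 = 3 * (P + Q + x + sqrt 3 * y)" and PQ: "x\<^sup>2 + y\<^sup>2 = P * Q"
    by (simp_all only: a_def b_def c_def P_def Q_def x_def y_def opposite_side_squares
        norm_product_square)
  have s3: "(sqrt 3)\<^sup>2 = (3::real)" by simp
  have "(\<kappa> + l * b\<^sup>2) * (\<kappa> + l * c\<^sup>2) = w 1" "(\<kappa> + l * c\<^sup>2) * (\<kappa> + l * a\<^sup>2) = w omega"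
    "(\<kappa> + l * a\<^sup>2) * (\<kappa> + l * b\<^sup>2) = w (cnj omega)"
    unfolding sq w_def harmonic_weights_real x_def[symmetric] y_def[symmetric] \<alpha>_def \<beta>_def h_def
      \<kappa>_def[symmetric] using PQ s3 by algebra+
  note w = this[symmetric]
  have "a * recip_center (quadratic_center k1 k2 l) a b c = a * b * c * w 1"
    "b * recip_center (quadratic_center k1 k2 l) b c a = a * b * c * w omega"
    "c * recip_center (quadratic_center k1 k2 l) c a b = a * b * c * w (cnj omega)"
    unfolding w recip_center_def
    unfolding a_def b_def c_def quadratic_center_fourier \<kappa>_def P_def Q_def
    by (simp_all only: mult_ac)
  then show "\<exists>k. let a = opposite_side p q 1; b = opposite_side p q omega;
        c = opposite_side p q (cnj omega); P = (cmod p)\<^sup>2; Q = (cmod q)\<^sup>2;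
        w = harmonic_weight (\<alpha> P Q) (\<beta> P Q) (9 * l\<^sup>2) (p * cnj q)
      in a * recip_center (quadratic_center k1 k2 l) a b c = k * w 1
        \<and> b * recip_center (quadratic_center k1 k2 l) b c a = k * w omega
        \<and> c * recip_center (quadratic_center k1 k2 l) c a b = k * w (cnj omega)"
    unfolding Let_def w_def P_def Q_def a_def b_def c_def by blast
next
  fix m P Q :: real
  assume m: "m > 0"
  show "\<alpha> (m * P) (m * Q) = m\<^sup>2 * \<alpha> P Q" "\<beta> (m * P) (m * Q) = m * \<beta> P Q"
    unfolding \<alpha>_def \<beta>_def h_def symmetric_part_scale[OF m]
    by (simp_all add: power2_eq_square algebra_simps)
qed

section \<open>Curves of triangle families\<close>

text \<open>
  The eigenvalue of the cyclic convolution with \<open>\<Psi> t\<close> on the character with coefficient \<open>p\<close>; the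
  eigenvalue on the conjugate character, with coefficient \<open>q\<close>, is its conjugate because \<open>\<Psi> t\<close> is real.
\<close>

definition multiplier :: "(real \<Rightarrow> real^3) \<Rightarrow> real \<Rightarrow> complex" where
  "multiplier \<Psi> t = (\<Psi> t $ 1 + \<Psi> t $ 2 * omega + \<Psi> t $ 3 * cnj omega) /
     (\<Psi> t $ 1 + \<Psi> t $ 2 + \<Psi> t $ 3)"

text \<open>
  The triangle of a family at time \<open>t\<close> degenerates to the centroid exactly when \<open>\<mu> = 0\<close>; for all other
  \<open>\<mu>\<close> it inherits \<open>\<bar>p\<bar> \<noteq> \<bar>q\<bar>\<close> from the original triangle.
\<close>

lemma multiplier_eq_0:
  assumes "\<Psi> t $ 1 + \<Psi> t $ 2 + \<Psi> t $ 3 \<noteq> 0"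
  shows "multiplier \<Psi> t = 0 \<longleftrightarrow> \<Psi> t $ 1 = \<Psi> t $ 2 \<and> \<Psi> t $ 2 = \<Psi> t $ 3"
proof -
  have "complex_of_real (\<Psi> t $ 1) + of_real (\<Psi> t $ 2) + of_real (\<Psi> t $ 3) \<noteq> 0"
    using assms by (simp flip: of_real_add)
  then have "multiplier \<Psi> t = 0 \<longleftrightarrow>
      complex_of_real (\<Psi> t $ 1) + \<Psi> t $ 2 * omega + \<Psi> t $ 3 * cnj omega = 0"
    by (simp add: multiplier_def)
  also have "\<dots> \<longleftrightarrow> \<Psi> t $ 1 = \<Psi> t $ 2 \<and> \<Psi> t $ 2 = \<Psi> t $ 3"
    by (auto simp: complex_eq_iff omega_def)
  finally show ?thesis .
qed

lemma family_vertices: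
  assumes S: "\<Psi> t $ 1 + \<Psi> t $ 2 + \<Psi> t $ 3 \<noteq> 0"
    and A: "A = fourier_vertex g p q 1" and B: "B = fourier_vertex g p q omega"
    and C: "C = fourier_vertex g p q (cnj omega)"
  defines "\<mu> \<equiv> multiplier \<Psi> t"
  shows "vertex_A \<Psi> A B C t = fourier_vertex g (\<mu> * p) (cnj \<mu> * q) 1"
    "vertex_B \<Psi> A B C t = fourier_vertex g (\<mu> * p) (cnj \<mu> * q) omega"
    "vertex_C \<Psi> A B C t = fourier_vertex g (\<mu> * p) (cnj \<mu> * q) (cnj omega)"
proof -
  define x y z where "x = complex_of_real (\<Psi> t $ 1)" and "y = complex_of_real (\<Psi> t $ 2)"
    and "z = complex_of_real (\<Psi> t $ 3)"
  have nz: "x + y + z \<noteq> 0" "y + z + x \<noteq> 0" "z + x + y \<noteq> 0"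
    using S by (simp_all add: x_def y_def z_def add_ac flip: of_real_add)
  have bary: "barycentric A B C r s u = point ((of_real r * (g + p + q)
      + of_real s * (g + omega * p + cnj omega * q)
      + of_real u * (g + cnj omega * p + omega * q)) / (of_real r + of_real s + of_real u))" for r s u
    unfolding barycentric_def A B C fourier_vertex_def
    by (simp add: vec_eq_iff forall_2 flip: of_real_add)
  have \<mu>: "(x + y + z) * \<mu> = x + y * omega + z * cnj omega"
    "(x + y + z) * cnj \<mu> = x + y * cnj omega + z * omega"
    using nz by (simp_all add: \<mu>_def multiplier_def x_def y_def z_def)
  have "x * (g + p + q) + y * (g + omega * p + cnj omega * q)
      + z * (g + cnj omega * p + omega * q) =
      (x + y + z) * g + 1 * (x + y * omega + z * cnj omega) * p
      + 1 * (x + y * cnj omega + z * omega) * q"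
    unfolding cnj_omega by (simp add: algebra_simps)
  also have "\<dots> = (g + 1 * (\<mu> * p) + 1 * (cnj \<mu> * q)) * (x + y + z)"
    unfolding \<mu>[symmetric] by (simp add: algebra_simps)
  finally show "vertex_A \<Psi> A B C t = fourier_vertex g (\<mu> * p) (cnj \<mu> * q) 1"
    unfolding vertex_A_def bary x_def[symmetric] y_def[symmetric] z_def[symmetric]
    using nz by (simp add: fourier_vertex_def)
  have "z * (g + p + q) + x * (g + omega * p + cnj omega * q)
      + y * (g + cnj omega * p + omega * q) =
      (z + x + y) * g + omega * (x + y * omega + z * cnj omega) * p
      + cnj omega * (x + y * cnj omega + z * omega) * q"
    unfolding cnj_omega using omega_square by algebra
  also have "\<dots> = (g + omega * (\<mu> * p) + cnj omega * (cnj \<mu> * q)) * (z + x + y)"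
    unfolding \<mu>[symmetric] by (simp add: algebra_simps)
  finally show "vertex_B \<Psi> A B C t = fourier_vertex g (\<mu> * p) (cnj \<mu> * q) omega"
    unfolding vertex_B_def bary x_def[symmetric] y_def[symmetric] z_def[symmetric]
    using nz by (simp add: fourier_vertex_def)
  have "y * (g + p + q) + z * (g + omega * p + cnj omega * q)
      + x * (g + cnj omega * p + omega * q) =
      (y + z + x) * g + cnj omega * (x + y * omega + z * cnj omega) * p
      + omega * (x + y * cnj omega + z * omega) * q"
    unfolding cnj_omega using omega_square by algebra
  also have "\<dots> = (g + cnj omega * (\<mu> * p) + omega * (cnj \<mu> * q)) * (y + z + x)"
    unfolding \<mu>[symmetric] by (simp add: algebra_simps)
  finally show "vertex_C \<Psi> A B C t = fourier_vertex g (\<mu> * p) (cnj \<mu> * q) (cnj omega)"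
    unfolding vertex_C_def bary x_def[symmetric] y_def[symmetric] z_def[symmetric]
    using nz by (simp add: fourier_vertex_def)
qed

text \<open>
  The curve is \<open>g + (1 - \<sigma>) (w E + cnj w F)\<close>, split into real and imaginary parts of \<open>w\<close>.  In the
  degenerate case \<open>\<mu> = 0\<close> the value \<open>w = 0 / 0 = 0\<close> gives the centroid, as it should.
\<close>

lemma scaled_curve:
  fixes g p q :: complex and \<sigma> t :: real
  assumes family: "triangle_family \<Psi>" and cubic: "cubic_center \<psi> U V" and pq: "cmod p \<noteq> cmod q"
    and A: "A = fourier_vertex g p q 1" and B: "B = fourier_vertex g p q omega"
    and C: "C = fourier_vertex g p q (cnj omega)"
    and def: "curve_defined (scaled_center \<psi> \<sigma>) \<Psi> A B C t"
  defines "E \<equiv> of_real (U ((cmod p)\<^sup>2) ((cmod q)\<^sup>2)) * (p\<^sup>2 * cnj q)"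
    and "F \<equiv> of_real (V ((cmod p)\<^sup>2) ((cmod q)\<^sup>2)) * (q\<^sup>2 * cnj p)"
    and "w \<equiv> multiplier \<Psi> t ^ 3 / (of_real (cmod (multiplier \<Psi> t)))\<^sup>2"
  shows "triangle_curve (scaled_center \<psi> \<sigma>) \<Psi> A B C t =
           centroid A B C + ((1 - \<sigma>) * Re w) *\<^sub>R point (E + F)
             + ((1 - \<sigma>) * Im w) *\<^sub>R point (\<i> * (E - F))"
proof -
  define \<mu> where "\<mu> = multiplier \<Psi> t"
  have S: "\<Psi> t $ 1 + \<Psi> t $ 2 + \<Psi> t $ 3 \<noteq> 0"
    using family by (simp add: triangle_family_def)
  have G: "centroid A B C = point g"
    unfolding A B C by (rule centroid_fourier)
  show ?thesis
  proof (cases "\<mu> = 0")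
    case True
    then show ?thesis
      using multiplier_eq_0[of \<Psi> t, OF S] by (simp add: triangle_curve_def w_def \<mu>_def)
  next
    case False
    define p' q' where "p' = \<mu> * p" and "q' = cnj \<mu> * q"
    let ?A = "fourier_vertex g p' q' 1" and ?B = "fourier_vertex g p' q' omega"
      and ?C = "fourier_vertex g p' q' (cnj omega)"
    note v = family_vertices[of \<Psi> t, OF S A B C, folded \<mu>_def, folded p'_def q'_def]
    have not_eq: "\<not> (\<Psi> t $ 1 = \<Psi> t $ 2 \<and> \<Psi> t $ 2 = \<Psi> t $ 3)"
      using False multiplier_eq_0[of \<Psi> t, OF S] by (simp add: \<mu>_def)
    have pq': "cmod p' \<noteq> cmod q'"
      using False pq by (simp add: p'_def q'_def norm_mult)
    have "opposite_side p' q' \<zeta> \<noteq> 0" if "cmod \<zeta> = 1" for \<zeta>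
      using pq' that by (auto simp: opposite_side_def norm_mult)
    then have sides: "opposite_side p' q' 1 \<noteq> 0" "opposite_side p' q' omega \<noteq> 0"
      "opposite_side p' q' (cnj omega) \<noteq> 0"
      by (simp_all add: cmod_omega)
    then have distinct: "?A \<noteq> ?B" "?B \<noteq> ?C" "?C \<noteq> ?A"
      by (simp_all flip: dist_fourier(1)[of g] dist_fourier(2)[of g] dist_fourier(3)[of g])
    have "center_defined (scaled_center \<psi> \<sigma>) ?A ?B ?C"
      using def not_eq by (auto simp: curve_defined_def v)
    then have cdef: "center_defined \<psi> ?A ?B ?C"
      using center_trace_scaled_center[OF sides, of \<psi> \<sigma>]
      by (auto simp: center_defined_def dist_fourier split: if_splits)
    have norms: "(cmod p')\<^sup>2 = (cmod \<mu>)\<^sup>2 * (cmod p)\<^sup>2" "(cmod q')\<^sup>2 = (cmod \<mu>)\<^sup>2 * (cmod q)\<^sup>2"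
      by (simp_all add: p'_def q'_def norm_mult power_mult_distrib)
    have pos: "(cmod \<mu>)\<^sup>2 > 0"
      using False by simp
    \<comment> \<open>Both squared moduli grow by \<open>\<bar>\<mu>\<bar>\<^sup>2\<close>, so homogeneity produces the denominator of \<open>w\<close>.\<close>
    have hom: "U ((cmod p')\<^sup>2) ((cmod q')\<^sup>2) = U ((cmod p)\<^sup>2) ((cmod q)\<^sup>2) / (cmod \<mu>)\<^sup>2"
      "V ((cmod p')\<^sup>2) ((cmod q')\<^sup>2) = V ((cmod p)\<^sup>2) ((cmod q)\<^sup>2) / (cmod \<mu>)\<^sup>2"
      unfolding norms using cubic pos unfolding cubic_center_def by blast+
    have "center_of \<psi> ?A ?B ?C = point (g
        + of_real (U ((cmod p')\<^sup>2) ((cmod q')\<^sup>2)) * (p'\<^sup>2 * cnj q')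
        + of_real (V ((cmod p')\<^sup>2) ((cmod q')\<^sup>2)) * (q'\<^sup>2 * cnj p'))"
      using cubic pq' cdef unfolding cubic_center_def by blast
    also have "of_real (U ((cmod p')\<^sup>2) ((cmod q')\<^sup>2)) * (p'\<^sup>2 * cnj q') = w * E"
      unfolding hom w_def E_def \<mu>_def[symmetric]
      by (simp add: p'_def q'_def power_mult_distrib power2_eq_square power3_eq_cube)
    also have "of_real (V ((cmod p')\<^sup>2) ((cmod q')\<^sup>2)) * (q'\<^sup>2 * cnj p') = cnj w * F"
      unfolding hom w_def F_def \<mu>_def[symmetric]
      by (simp add: p'_def q'_def power_mult_distrib power2_eq_square power3_eq_cube)
    also have "g + w * E + cnj w * F = g + (w * E + cnj w * F)"
      by (rule add.assoc)
    also have "w * E + cnj w * F = Re w *\<^sub>R (E + F) + Im w *\<^sub>R (\<i> * (E - F))"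
      by (simp add: complex_eq_iff algebra_simps)
    finally have c: "center_of \<psi> ?A ?B ?C =
        point g + (Re w *\<^sub>R point (E + F) + Im w *\<^sub>R point (\<i> * (E - F)))"
      by (simp only: point_add point_scaleR)
    have "triangle_curve (scaled_center \<psi> \<sigma>) \<Psi> A B C t =
        (1 - \<sigma>) *\<^sub>R center_of \<psi> ?A ?B ?C + \<sigma> *\<^sub>R point g"
      using not_eq center_of_scaled_center[OF distinct cdef, of \<sigma>]
      by (auto simp: triangle_curve_def v centroid_fourier)
    then show ?thesis
      unfolding c G by (simp add: algebra_simps)
  qed
qed

lemma semi_invariant_scaled:
  assumes "triangle_family \<Psi>" "cubic_center \<psi> U V"
  shows "semi_invariant (scaled_center \<psi> \<sigma>) \<Psi>"
proof -
  define w where "w = (\<lambda>t. multiplier \<Psi> t ^ 3 / (of_real (cmod (multiplier \<Psi> t)))\<^sup>2)"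
  have "\<exists>Vx Vy. \<forall>t. curve_defined (scaled_center \<psi> \<sigma>) \<Psi> A B C t \<longrightarrow>
      triangle_curve (scaled_center \<psi> \<sigma>) \<Psi> A B C t =
      centroid A B C + ((1 - \<sigma>) * Re (w t)) *\<^sub>R Vx + ((1 - \<sigma>) * Im (w t)) *\<^sub>R Vy"
    if "admissible_triangle A B C" for A B C
  proof -
    obtain g p q where v: "A = fourier_vertex g p q 1" "B = fourier_vertex g p q omega"
      "C = fourier_vertex g p q (cnj omega)"
      by (rule triangle_fourier)
    with that have "cmod p \<noteq> cmod q"
      using admissible_fourier(1) by blast
    from scaled_curve[OF assms this v, folded w_def] show ?thesis
      unfolding w_def by blast
  qed
  note curves = this
  show ?thesis
    unfolding semi_invariant_def
    by (rule exI[of _ "\<lambda>t. (1 - \<sigma>) * Re (w t)"], rule exI[of _ "\<lambda>t. (1 - \<sigma>) * Im (w t)"])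
      (use curves in blast)
qed

lemma similarity_map_mult:
  assumes "z \<noteq> 0"
  shows "similarity_map (\<lambda>x. point (Complex (x $ 1) (x $ 2) * z))"
proof -
  define r where "r = cmod z"
  have r: "r \<noteq> 0" using assms by (simp add: r_def)
  define c s where "c = Re z / r" and "s = Im z / r"
  have "c\<^sup>2 + s\<^sup>2 = (cmod z)\<^sup>2 / r\<^sup>2"
    unfolding cmod_power2 by (simp add: c_def s_def power_divide add_divide_distrib)
  then have cs: "c * c + s * s = 1"
    using r by (simp add: r_def power2_eq_square)
  define M :: "real^2^2" where "M = vector [vector [c, - s], vector [s, c]]"
  have "orthogonal_matrix M"
    using cs by (simp add: orthogonal_matrix_def M_def matrix_matrix_mult_def transpose_def mat_def
        vec_eq_iff forall_2 sum_2 algebra_simps)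
  moreover have "det M = 1"
    using cs by (simp add: det_2 M_def)
  ultimately have "similarity_map ((\<lambda>x. r *\<^sub>R x) \<circ> (\<lambda>x. M *v x))"
    using r by (intro similarity_map.intros) (simp_all add: rotation_matrix_def)
  also have "(\<lambda>x. r *\<^sub>R x) \<circ> (\<lambda>x. M *v x) = (\<lambda>x. point (Complex (x $ 1) (x $ 2) * z))"
    using r by (intro ext)
      (simp add: vec_eq_iff forall_2 M_def matrix_vector_mult_def sum_2 c_def s_def field_simps)
  finally show ?thesis .
qed

lemma similarity_map_cnj_mult:
  assumes "z \<noteq> 0"
  shows "similarity_map (\<lambda>x. point (cnj (Complex (x $ 1) (x $ 2)) * z))"
proof -
  define n :: "real^2" where "n = vector [0, 1]"
  have "n \<noteq> 0"
    by (simp add: n_def vec_eq_iff forall_2)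
  then have "similarity_map ((\<lambda>x. point (Complex (x $ 1) (x $ 2) * z)) \<circ>
      (\<lambda>x. x - (2 * (x \<bullet> n) / (n \<bullet> n)) *\<^sub>R n))"
    by (intro similarity_map.intros(2,4) similarity_map_mult assms)
  also have "(\<lambda>x. point (Complex (x $ 1) (x $ 2) * z)) \<circ>
      (\<lambda>x. x - (2 * (x \<bullet> n) / (n \<bullet> n)) *\<^sub>R n) =
      (\<lambda>x. point (cnj (Complex (x $ 1) (x $ 2)) * z))"
    by (intro ext) (simp add: n_def inner_vec_def sum_2 complex_cnj)
  finally show ?thesis .
qed

text \<open>
  If \<open>F = 0\<close>, then \<open>w \<mapsto> w E\<close> is a rotation followed by a scaling; if \<open>E = 0\<close>, then \<open>w \<mapsto> cnj w F\<close> has a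
  reflection in front of it.  The factor \<open>1 - \<sigma>\<close> goes into the functions of \<open>t\<close>, so that the linear
  map remains a similarity for \<open>\<sigma> = 1\<close>.
\<close>

lemma invariant_scaled:
  assumes family: "triangle_family \<Psi>" and cubic: "cubic_center \<psi> U V"
    and one: "\<And>P Q. P > 0 \<Longrightarrow> Q > 0 \<Longrightarrow> P \<noteq> Q \<Longrightarrow> U P Q = 0 \<longleftrightarrow> V P Q \<noteq> 0"
  shows "invariant (scaled_center \<psi> \<sigma>) \<Psi>"
proof -
  define w where "w = (\<lambda>t. multiplier \<Psi> t ^ 3 / (of_real (cmod (multiplier \<Psi> t)))\<^sup>2)"
  have "\<exists>Vx Vy. similarity_map (\<lambda>x. (x $ 1) *\<^sub>R Vx + (x $ 2) *\<^sub>R Vy) \<and>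
      (\<forall>t. curve_defined (scaled_center \<psi> \<sigma>) \<Psi> A B C t \<longrightarrow>
      triangle_curve (scaled_center \<psi> \<sigma>) \<Psi> A B C t =
      centroid A B C + ((1 - \<sigma>) * Re (w t)) *\<^sub>R Vx + ((1 - \<sigma>) * Im (w t)) *\<^sub>R Vy)"
    if "admissible_triangle A B C" for A B C
  proof -
    obtain g p q where v: "A = fourier_vertex g p q 1" "B = fourier_vertex g p q omega"
      "C = fourier_vertex g p q (cnj omega)"
      by (rule triangle_fourier)
    with that have pq: "cmod p \<noteq> cmod q" "p \<noteq> 0" "q \<noteq> 0"
      using admissible_fourier by blast+
    define E where "E = of_real (U ((cmod p)\<^sup>2) ((cmod q)\<^sup>2)) * (p\<^sup>2 * cnj q)"
    define F where "F = of_real (V ((cmod p)\<^sup>2) ((cmod q)\<^sup>2)) * (q\<^sup>2 * cnj p)"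
    have "U ((cmod p)\<^sup>2) ((cmod q)\<^sup>2) = 0 \<longleftrightarrow> V ((cmod p)\<^sup>2) ((cmod q)\<^sup>2) \<noteq> 0"
      using pq by (intro one) simp_all
    then have "E = 0 \<and> F \<noteq> 0 \<or> E \<noteq> 0 \<and> F = 0"
      using pq by (auto simp: E_def F_def)
    moreover have "(\<lambda>x::real^2. (x $ 1) *\<^sub>R point E + (x $ 2) *\<^sub>R point (\<i> * E)) =
        (\<lambda>x. point (Complex (x $ 1) (x $ 2) * E))"
      "(\<lambda>x::real^2. (x $ 1) *\<^sub>R point F + (x $ 2) *\<^sub>R point (- (\<i> * F))) =
        (\<lambda>x. point (cnj (Complex (x $ 1) (x $ 2)) * F))"
      by (intro ext; simp add: vec_eq_iff forall_2)+
    ultimately have "similarity_map (\<lambda>x. (x $ 1) *\<^sub>R point (E + F) + (x $ 2) *\<^sub>R point (\<i> * (E - F)))"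
      using similarity_map_mult[of E] similarity_map_cnj_mult[of F] by auto
    moreover note scaled_curve[OF family cubic pq(1) v, folded E_def F_def, of \<sigma>]
    ultimately show ?thesis
      unfolding w_def by blast
  qed
  note curves = this
  show ?thesis
    unfolding invariant_def
    by (rule exI[of _ "\<lambda>t. (1 - \<sigma>) * Re (w t)"], rule exI[of _ "\<lambda>t. (1 - \<sigma>) * Im (w t)"])
      (use curves in blast)
qed

section \<open>The centers of the two families and the four invariant ones\<close>

lemma cubic_center_Omega:
  assumes "\<psi> \<in> Omega"
  shows "\<exists>U V. cubic_center \<psi> U V"
proof -
  have "(\<exists>k1 k2 l. \<psi> = quadratic_center k1 k2 l) \<or>
      (\<exists>k1 k2 l. \<psi> = recip_center (quadratic_center k1 k2 l))"
    using assms unfolding Omega_def Gamma_set_def Xi_set_def psi_Gamma_quadratic psi_Xi_quadratic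
    by blast
  then show ?thesis
    using cubic_center_quadratic cubic_center_recip_quadratic by blast
qed

lemma symmetric_part_Gamma:
  "symmetric_part (sqrt 3 * l0) (4 * l1) P Q = 3 * sqrt 3 * (3 * l0 * (P + Q) + l1 * \<bar>P - Q\<bar>)"
  by (simp add: symmetric_part_def algebra_simps)

text \<open>
  The factor \<open>l0 (P - Q) - l1 \<bar>P - Q\<bar>\<close> shows the special role of \<open>l0 = \<plusminus> l1\<close>: then one of the two
  numerators vanishes, and the sign together with the orientation of the triangle decides which.
\<close>

lemma cubic_center_psi_Gamma:
  fixes l0 l1 :: real
  defines "D \<equiv> \<lambda>P Q. \<bar>P - Q\<bar> * (l0 * \<bar>P - Q\<bar> + l1 * (P + Q))"
  shows "cubic_center (psi_Gamma l0 l1) (\<lambda>P Q. (l0 * (P - Q) - l1 * \<bar>P - Q\<bar>) / D P Q)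
           (\<lambda>P Q. (- (l0 * (P - Q)) - l1 * \<bar>P - Q\<bar>) / D P Q)"
proof -
  let ?k = "symmetric_part (sqrt 3 * l0) (4 * l1)" and ?l = "- 2 * sqrt 3 * l0"
  have U: "- 3 * (?k P Q + 6 * ?l * (P + Q)) + 9 * ?l * Q =
      9 * sqrt 3 * (l0 * (P - Q) - l1 * \<bar>P - Q\<bar>)" for P Q
    unfolding symmetric_part_Gamma by (simp add: algebra_simps)
  have V: "- 3 * (?k P Q + 6 * ?l * (P + Q)) + 9 * ?l * P =
      9 * sqrt 3 * (- (l0 * (P - Q)) - l1 * \<bar>P - Q\<bar>)" for P Q
    unfolding symmetric_part_Gamma by (simp add: algebra_simps)
  have D: "3 * (?k P Q * (P + Q) + 3 * ?l * (P + Q)\<^sup>2 + 6 * ?l * P * Q) = 9 * sqrt 3 * D P Q" for P Q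
  proof -
    have "D P Q = l0 * (P - Q)\<^sup>2 + l1 * (P + Q) * \<bar>P - Q\<bar>"
      unfolding D_def power2_abs[of "P - Q", symmetric] by (simp add: power2_eq_square algebra_simps)
    then show ?thesis
      unfolding symmetric_part_Gamma by (simp only:) (simp add: power2_eq_square algebra_simps)
  qed
  show ?thesis
    using cubic_center_quadratic[of "sqrt 3 * l0" "4 * l1" ?l]
    unfolding U V D psi_Gamma_quadratic by simp
qed

lemma cubic_center_recip_psi_Gamma:
  fixes l0 l1 :: real
  defines "D \<equiv> \<lambda>P Q. \<bar>P - Q\<bar> * ((l0\<^sup>2 + l1\<^sup>2) * \<bar>P - Q\<bar> + 2 * l0 * l1 * (P + Q))"
  shows "cubic_center (recip_center (psi_Gamma l0 l1))
           (\<lambda>P Q. - 2 * l0 * (l0 * (P - Q) + l1 * \<bar>P - Q\<bar>) / D P Q)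
           (\<lambda>P Q. - 2 * l0 * (- (l0 * (P - Q)) + l1 * \<bar>P - Q\<bar>) / D P Q)"
proof -
  let ?l = "- 2 * sqrt 3 * l0"
  let ?h = "\<lambda>P Q. symmetric_part (sqrt 3 * l0) (4 * l1) P Q + 3 * ?l * (P + Q)"
  have h: "?h P Q = 3 * sqrt 3 * (l0 * (P + Q) + l1 * \<bar>P - Q\<bar>)" for P Q
    unfolding symmetric_part_Gamma by (simp add: algebra_simps)
  have s3: "sqrt 3 * (sqrt 3 * x) = 3 * x" for x :: real
    by (simp flip: mult.assoc)
  have U: "3 * ?l * ?h P Q + 9 * ?l\<^sup>2 * Q = 27 * (- 2 * l0 * (l0 * (P - Q) + l1 * \<bar>P - Q\<bar>))" for P Q
    unfolding h by (simp add: power2_eq_square algebra_simps s3)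
  have V: "3 * ?l * ?h P Q + 9 * ?l\<^sup>2 * P = 27 * (- 2 * l0 * (- (l0 * (P - Q)) + l1 * \<bar>P - Q\<bar>))" for P Q
    unfolding h by (simp add: power2_eq_square algebra_simps s3)
  have D: "(?h P Q)\<^sup>2 - 9 * ?l\<^sup>2 * (P * Q) = 27 * D P Q" for P Q
  proof -
    have "D P Q = l0\<^sup>2 * (P - Q)\<^sup>2 + l1\<^sup>2 * \<bar>P - Q\<bar>\<^sup>2 + 2 * l0 * l1 * (P + Q) * \<bar>P - Q\<bar>"
      unfolding D_def power2_abs[of "P - Q", symmetric] by (simp add: power2_eq_square algebra_simps)
    moreover have "(?h P Q)\<^sup>2 - 9 * ?l\<^sup>2 * (P * Q) =
        27 * ((l0 * (P + Q) + l1 * \<bar>P - Q\<bar>)\<^sup>2 - 4 * l0\<^sup>2 * (P * Q))"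
      unfolding h by (simp add: power_mult_distrib)
    ultimately show ?thesis
      by (simp add: power2_eq_square algebra_simps)
  qed
  have "27 * x / (27 * y) = x / y" for x y :: real
    by simp
  then show ?thesis
    using cubic_center_recip_quadratic[of "sqrt 3 * l0" "4 * l1" ?l]
    unfolding U V D psi_Gamma_quadratic by (simp only:)
qed

text \<open>
  The denominators do not vanish because \<open>0 < \<bar>P - Q\<bar> < P + Q\<close> for a triangle that is neither
  degenerate nor equilateral.
\<close>

lemma invariant_Omega_inv:
  assumes "triangle_family \<Psi>" "\<phi> \<in> Omega_inv"
  shows "invariant (scaled_center \<phi> \<sigma>) \<Psi>"
proof -
  \<comment> \<open>The factors 1 stand for \<open>l1\<close>, and \<open>e\<close> for \<open>l0\<close>.\<close>
  have denominators: "\<bar>P - Q\<bar> * (e * \<bar>P - Q\<bar> + 1 * (P + Q)) \<noteq> 0 \<and>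
      \<bar>P - Q\<bar> * ((e\<^sup>2 + 1\<^sup>2) * \<bar>P - Q\<bar> + 2 * e * 1 * (P + Q)) \<noteq> 0"
    if "P > 0" "Q > 0" "P \<noteq> Q" "e = 1 \<or> e = - 1" for P Q e :: real
    using that(4)
  proof
    assume e: "e = 1"
    have "\<bar>P - Q\<bar> > 0" "P + Q > 0"
      using that by simp_all
    then have "\<bar>P - Q\<bar> + (P + Q) > 0"
      by linarith
    then show ?thesis
      using that(3) by (simp add: e)
  next
    assume e: "e = - 1"
    have "\<bar>P - Q\<bar> < P + Q"
      using that by (simp add: abs_less_iff)
    then show ?thesis
      using that(3) by (simp add: e)
  qed
  \<comment> \<open>With nonzero denominators, the criterion for \<open>U\<close> and \<open>V\<close> is one for their numerators.\<close>
  have quotient: "x / z = 0 \<longleftrightarrow> y / z \<noteq> 0" if "z \<noteq> 0" "x = 0 \<longleftrightarrow> y \<noteq> 0" for x y z :: real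
    using that by simp
  have exactly_one: "e * (P - Q) = \<bar>P - Q\<bar> \<longleftrightarrow> - (e * (P - Q)) \<noteq> \<bar>P - Q\<bar>"
    if "P \<noteq> Q" "e = 1 \<or> e = - 1" for P Q e :: real
  proof -
    define x where "x = e * (P - Q)"
    have "\<bar>P - Q\<bar> = \<bar>x\<bar>" "x \<noteq> 0"
      using that by (auto simp: x_def abs_mult)
    then show ?thesis
      unfolding x_def[symmetric] by (cases "x \<ge> 0") simp_all
  qed
  have shift: "x - 1 * y = 0 \<longleftrightarrow> x = y" "x + 1 * y = 0 \<longleftrightarrow> - x = y" for x y :: real
    by auto
  have direct: "invariant (scaled_center (psi_Gamma e 1) \<sigma>) \<Psi>" if e: "e = 1 \<or> e = - 1" for e
  proof (rule invariant_scaled[OF assms(1) cubic_center_psi_Gamma], rule quotient)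
    fix P Q :: real
    assume PQ: "P > 0" "Q > 0" "P \<noteq> Q"
    show "\<bar>P - Q\<bar> * (e * \<bar>P - Q\<bar> + 1 * (P + Q)) \<noteq> 0"
      by (rule denominators[OF PQ e, THEN conjunct1])
    show "e * (P - Q) - 1 * \<bar>P - Q\<bar> = 0 \<longleftrightarrow> - (e * (P - Q)) - 1 * \<bar>P - Q\<bar> \<noteq> 0"
      unfolding shift by (rule exactly_one[OF PQ(3) e])
  qed
  have recip: "invariant (scaled_center (recip_center (psi_Gamma e 1)) \<sigma>) \<Psi>"
    if e: "e = 1 \<or> e = - 1" for e
  proof (rule invariant_scaled[OF assms(1) cubic_center_recip_psi_Gamma], rule quotient)
    fix P Q :: real
    assume PQ: "P > 0" "Q > 0" "P \<noteq> Q"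
    show "\<bar>P - Q\<bar> * ((e\<^sup>2 + 1\<^sup>2) * \<bar>P - Q\<bar> + 2 * e * 1 * (P + Q)) \<noteq> 0"
      by (rule denominators[OF PQ e, THEN conjunct2])
    show "- 2 * e * (e * (P - Q) + 1 * \<bar>P - Q\<bar>) = 0 \<longleftrightarrow>
        - 2 * e * (- (e * (P - Q)) + 1 * \<bar>P - Q\<bar>) \<noteq> 0"
    proof -
      have "- 2 * e \<noteq> 0"
        using e by auto
      then show ?thesis
        unfolding mult_eq_0_iff[of "- 2 * e"] shift minus_minus using exactly_one[OF PQ(3) e] by simp
    qed
  qed
  show ?thesis
    using assms(2) direct[of 1] direct[of "- 1"] recip[of 1] recip[of "- 1"]
    by (auto simp: Omega_inv_def)
qed

theorem corollary4:
  shows "(\<forall>\<psi> \<in> scaled_family Omega. \<forall>\<Psi>.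
            triangle_family \<Psi> \<and> decomposable \<Psi> \<longrightarrow> semi_invariant \<psi> \<Psi>) \<and>
         (\<forall>\<psi> \<in> scaled_family Omega_inv. \<forall>\<Psi>.
            triangle_family \<Psi> \<and> decomposable \<Psi> \<longrightarrow> invariant \<psi> \<Psi>)"
proof (intro conjI ballI allI impI)
  fix \<psi> \<Psi>
  assume "\<psi> \<in> scaled_family Omega" and \<Psi>: "triangle_family \<Psi> \<and> decomposable \<Psi>"
  then obtain \<phi> \<sigma> where \<psi>: "\<psi> = scaled_center \<phi> \<sigma>" "\<phi> \<in> Omega"
    by (auto simp: scaled_family_def)
  obtain U V where "cubic_center \<phi> U V"
    using cubic_center_Omega[OF \<psi>(2)] by blast
  with \<Psi> show "semi_invariant \<psi> \<Psi>"
    unfolding \<psi>(1) by (intro semi_invariant_scaled) simp_all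
next
  fix \<psi> \<Psi>
  assume "\<psi> \<in> scaled_family Omega_inv" and \<Psi>: "triangle_family \<Psi> \<and> decomposable \<Psi>"
  then obtain \<phi> \<sigma> where \<psi>: "\<psi> = scaled_center \<phi> \<sigma>" "\<phi> \<in> Omega_inv"
    by (auto simp: scaled_family_def)
  with \<Psi> show "invariant \<psi> \<Psi>"
    by (simp add: invariant_Omega_inv)
qed

end
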